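(* Let $G$ be a connected edge-ordered graph having at least one edge, and let $G^R$ denote its reverse. If $G$ or $G^R$ is a semi-caterpillar of order chromatic number $2$, then $\mathrm{ex}_<(n,G)=O(n)$. In every other case (that is, for any other connected edge-ordered graph $G$ with at least one edge) $\mathrm{ex}_<(n,G)=\Omega(n\log n)$.
   Context: An edge-ordered graph is a finite simple graph together with a linear order on its edge set; the simple graph is called its underlying simple graph, and an edge-ordering of a simple graph $H$ is an edge-ordered graph with underlying simple graph $H$. An isomorphism of edge-ordered graphs is a graph isomorphism respecting the edge-order; subgraphs inherit the edge-order. An edge-ordered graph $G$ contains an edge-ordered graph $H$ if $H$ is isomorphic to a subgraph of $G$ (not necessarily induced); otherwise $G$ avoids $H$. An edge-ordered graph is connected if its underlying simple graph is. For an edge-ordered graph $H$ with at least one edge, $\mathrm{ex}_<(n,H)$ is the maximal number of edges in an edge-ordered graph on $n$ vertices that avoids $H$. Asymptotic notation is for $H$ fixed and $n\to\infty$ (implied constants may depend on $H$). The order chromatic number $\chi_<(G)$ of an edge-ordered graph $G$ is the smallest chromatic number $\chi(H)$ of a finite simple graph $H$ such that all edge-orderings of $H$ contain $G$; it is $\infty$ if no such $H$ exists. Two edges $e_1<e_2$ of an edge-ordered graph $G$ are consecutive if no edge $e$ of $G$ satisfies $e_1<e<e_2$. An edge-ordered graph $G$ is a semi-caterpillar if its underlying simple graph is a tree with at least one edge and any two consecutive edges of $G$ are either adjacent (share a vertex) or are directly connected by an edge larger than both of them (i.e. there is an edge, larger than both, with one end on each of the two edges). The reverse $G^R$ of $G$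 has the same underlying simple graph and the reversed edge-order. *)

theory Defs
  imports
    Complex_Main
    "HOL-Library.Extended_Nat"
    "HOL-Library.Landau_Symbols"
begin

section \<open>Finite simple graphs\<close>

record 'a sgraph =
  verts :: "'a set"
  edges :: "'a set set"

definition simple_graph :: "('a, 'm) sgraph_scheme \<Rightarrow> bool" where
  "simple_graph H \<longleftrightarrow>
     finite (verts H) \<and> edges H \<subseteq> {e. e \<subseteq> verts H \<and> card e = 2}"

definition adjacency :: "('a, 'm) sgraph_scheme \<Rightarrow> ('a \<times> 'a) set" where
  "adjacency H = {(u, v). {u, v} \<in> edges H}"

definition connected_graph :: "('a, 'm) sgraph_scheme \<Rightarrow> bool" where
  "connected_graph H \<longleftrightarrow>
     verts H \<noteq> {} \<and> (\<forall>u \<in> verts H. \<forall>v \<in> verts H. (u, v) \<in> (adjacency H)\<^sup>*)"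

text \<open>A cycle is given by the list of its (distinct) vertices; the closing edge joins
  the last vertex to the first.\<close>

definition is_cycle :: "('a, 'm) sgraph_scheme \<Rightarrow> 'a list \<Rightarrow> bool" where
  "is_cycle H vs \<longleftrightarrow>
     length vs \<ge> 3 \<and> distinct vs \<and> set vs \<subseteq> verts H \<and>
     (\<forall>i. Suc i < length vs \<longrightarrow> {vs ! i, vs ! Suc i} \<in> edges H) \<and>
     {last vs, hd vs} \<in> edges H"

definition is_tree :: "('a, 'm) sgraph_scheme \<Rightarrow> bool" where
  "is_tree H \<longleftrightarrow> simple_graph H \<and> connected_graph H \<and> \<not> (\<exists>vs. is_cycle H vs)"

definition proper_colouring :: "('a, 'm) sgraph_scheme \<Rightarrow> nat \<Rightarrow> ('a \<Rightarrow> nat) \<Rightarrow> bool" where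
  "proper_colouring H k c \<longleftrightarrow>
     (\<forall>v \<in> verts H. c v < k) \<and> (\<forall>u v. {u, v} \<in> edges H \<longrightarrow> c u \<noteq> c v)"

definition chromatic_number :: "('a, 'm) sgraph_scheme \<Rightarrow> nat" where
  "chromatic_number H = (LEAST k. \<exists>c. proper_colouring H k c)"


section \<open>Edge-ordered graphs\<close>

text \<open>The linear order on the edges is the reflexive one (\<open>linear_order_on\<close>);
  its strict part is \<open>edge_less\<close>.\<close>

record 'a eograph = "'a sgraph" +
  edge_le :: "('a set \<times> 'a set) set"

definition edge_ordered_graph :: "'a eograph \<Rightarrow> bool" where
  "edge_ordered_graph G \<longleftrightarrow> simple_graph G \<and> linear_order_on (edges G) (edge_le G)"

abbreviation underlying :: "'a eograph \<Rightarrow> 'a sgraph" where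
  "underlying G \<equiv> sgraph.truncate G"

definition edge_ordering_of :: "'a sgraph \<Rightarrow> 'a eograph \<Rightarrow> bool" where
  "edge_ordering_of H G \<longleftrightarrow> edge_ordered_graph G \<and> underlying G = H"

definition edge_less :: "'a eograph \<Rightarrow> 'a set \<Rightarrow> 'a set \<Rightarrow> bool" where
  "edge_less G e f \<longleftrightarrow> (e, f) \<in> edge_le G \<and> e \<noteq> f"

definition reverse_eo :: "'a eograph \<Rightarrow> 'a eograph" where
  "reverse_eo G = G\<lparr>edge_le := (edge_le G)\<inverse>\<rparr>"

definition eo_subgraph :: "'a eograph \<Rightarrow> 'a eograph \<Rightarrow> bool" where
  "eo_subgraph S G \<longleftrightarrow>
     edge_ordered_graph S \<and> verts S \<subseteq> verts G \<and> edges S \<subseteq> edges G \<and>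
     edge_le S = Restr (edge_le G) (edges S)"

definition eo_isomorphism :: "('a \<Rightarrow> 'b) \<Rightarrow> 'a eograph \<Rightarrow> 'b eograph \<Rightarrow> bool" where
  "eo_isomorphism f G H \<longleftrightarrow>
     bij_betw f (verts G) (verts H) \<and>
     (\<forall>u \<in> verts G. \<forall>v \<in> verts G. {u, v} \<in> edges G \<longleftrightarrow> {f u, f v} \<in> edges H) \<and>
     (\<forall>e \<in> edges G. \<forall>e' \<in> edges G. (e, e') \<in> edge_le G \<longleftrightarrow> (f ` e, f ` e') \<in> edge_le H)"

definition eo_contains :: "'b eograph \<Rightarrow> 'a eograph \<Rightarrow> bool" where
  "eo_contains G H \<longleftrightarrow> (\<exists>S f. eo_subgraph S G \<and> eo_isomorphism f H S)"

text \<open>Every finite graph has an isomorphic copy on natural numbers, so the host graphs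
  below are taken with vertices in \<open>nat\<close>, while the pattern may have any vertex type.
  If the pattern has an edge, the set in \<open>ex_eo\<close> is finite and nonempty (it contains
  the edge count of the edgeless graph), so the maximum is meaningful.\<close>

definition ex_eo :: "nat \<Rightarrow> 'a eograph \<Rightarrow> nat" where
  "ex_eo n H = Max {card (edges G) | G :: nat eograph.
     edge_ordered_graph G \<and> card (verts G) = n \<and> \<not> eo_contains G H}"

text \<open>The infimum of the empty set in \<open>enat\<close> is \<open>\<infinity>\<close>, and the infimum of a nonempty set
  is its least element.\<close>

definition order_chromatic_number :: "'a eograph \<Rightarrow> enat" where
  "order_chromatic_number G = Inf {enat (chromatic_number H) | H :: nat sgraph.
     simple_graph H \<and> (\<forall>K. edge_ordering_of H K \<longrightarrow> eo_contains K G)}"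

definition consecutive_edges :: "'a eograph \<Rightarrow> 'a set \<Rightarrow> 'a set \<Rightarrow> bool" where
  "consecutive_edges G e1 e2 \<longleftrightarrow>
     e1 \<in> edges G \<and> e2 \<in> edges G \<and> edge_less G e1 e2 \<and>
     \<not> (\<exists>e \<in> edges G. edge_less G e1 e \<and> edge_less G e e2)"

definition semi_caterpillar :: "'a eograph \<Rightarrow> bool" where
  "semi_caterpillar G \<longleftrightarrow>
     edge_ordered_graph G \<and> is_tree (underlying G) \<and> edges G \<noteq> {} \<and>
     (\<forall>e1 e2. consecutive_edges G e1 e2 \<longrightarrow>
        e1 \<inter> e2 \<noteq> {} \<or>
        (\<exists>u \<in> e1. \<exists>v \<in> e2.
           {u, v} \<in> edges G \<and> edge_less G e1 {u, v} \<and> edge_less G e2 {u, v}))"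

end

theory Submission
  imports Defs "HOL-Library.Product_Lexorder"
begin

text \<open>
  If \<open>G\<close> has order chromatic number 2, it embeds into a lexicographically ordered bipartite graph:
  its vertices split into linearly ordered rows and unordered columns, and the edges at a row
  precede all edges at a later row. If the order chromatic number is not 2, complete bipartite
  graphs give a quadratic lower bound.

  Lower bound: the bipartite graph with edges \<open>(x, x + 2 ^ k)\<close> has about \<open>n log n\<close> edges. Label its
  edges lexicographically by \<open>(\<plusminus>y, \<plusminus>x)\<close>, or by \<open>x + y\<close>. If \<open>G\<close> occurs in all four lexicographic
  hosts, then no row is extreme between two neighbouring rows of a path, so that consecutive rows
  share a column. In the host with label \<open>x + y\<close>, an edge \<open>xy\<close> smaller than \<open>xz\<close> forces all edges at
  \<open>y\<close> below \<open>xz\<close>, and dually; so the shared column is the last one of the earlier row (or the first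
  one of the later row), and \<open>G\<close> (or its reverse) is a semi-caterpillar.

  Upper bound: a semi-caterpillar is grown row by row, every new row being attached at the last
  column of the previous one. Call an ordered pair \<open>(x, y)\<close> bad for a pattern if no copy of the
  pattern has its last row at \<open>x\<close> and its last column at \<open>y\<close>. By induction, only linearly many pairs
  \<open>(x, y)\<close> are bad for one pattern while \<open>(y, x)\<close> is bad for another: among pairs good for both
  smaller patterns and bad for both larger ones, an edge \<open>xy\<close> has few edges at \<open>x\<close> between the
  least edge at \<open>y\<close> and itself, and few at \<open>y\<close> between the least edge at \<open>x\<close> and itself; one of the
  two least edges comes first, so \<open>xy\<close> is among the lowest edges at one of its ends.
\<close>

section \<open>Edge-ordered graphs and their reverses\<close>

lemma verts_underlying [simp]: "verts (underlying G) = verts G"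
  and edges_underlying [simp]: "edges (underlying G) = edges G"
  by (simp_all add: sgraph.truncate_def)

lemma verts_reverse [simp]: "verts (reverse_eo G) = verts G"
  and edges_reverse [simp]: "edges (reverse_eo G) = edges G"
  and underlying_reverse [simp]: "underlying (reverse_eo G) = underlying G"
  and reverse_reverse [simp]: "reverse_eo (reverse_eo G) = G"
  by (simp_all add: reverse_eo_def sgraph.truncate_def)

lemma edge_less_reverse [simp]: "edge_less (reverse_eo G) e f \<longleftrightarrow> edge_less G f e"
  by (auto simp: edge_less_def reverse_eo_def)

lemma edge_ordered_reverse [simp]: "edge_ordered_graph (reverse_eo G) \<longleftrightarrow> edge_ordered_graph G"
  by (simp add: edge_ordered_graph_def simple_graph_def) (simp add: reverse_eo_def)

lemma edge_ordered_graphD: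
  assumes "edge_ordered_graph G"
  shows "finite (verts G)" "finite (edges G)"
    "\<And>e. e \<in> edges G \<Longrightarrow> e \<subseteq> verts G" "\<And>e. e \<in> edges G \<Longrightarrow> card e = 2"
proof -
  show v: "finite (verts G)" and e: "\<And>e. e \<in> edges G \<Longrightarrow> e \<subseteq> verts G" and "\<And>e. e \<in> edges G \<Longrightarrow> card e = 2"
    using assms by (auto simp: edge_ordered_graph_def simple_graph_def)
  show "finite (edges G)"
    by (rule finite_subset[of _ "Pow (verts G)"]) (use v e in auto)
qed

lemma edge_less_trans:
  "edge_ordered_graph G \<Longrightarrow> edge_less G e f \<Longrightarrow> edge_less G f g \<Longrightarrow> edge_less G e g"
  unfolding edge_less_def edge_ordered_graph_def order_on_defs
  by (metis antisymD transD)

lemma edge_less_asym: "edge_ordered_graph G \<Longrightarrow> edge_less G e f \<Longrightarrow> \<not> edge_less G f e"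
  unfolding edge_less_def edge_ordered_graph_def order_on_defs
  by (metis antisymD)

lemma edge_less_irrefl [simp]: "\<not> edge_less G e e"
  by (simp add: edge_less_def)

lemma edge_less_linear:
  "edge_ordered_graph G \<Longrightarrow> e \<in> edges G \<Longrightarrow> f \<in> edges G \<Longrightarrow> e \<noteq> f \<Longrightarrow> edge_less G e f \<or> edge_less G f e"
  unfolding edge_less_def edge_ordered_graph_def order_on_defs total_on_def
  by metis

lemma edge_less_edges:
  "edge_ordered_graph G \<Longrightarrow> edge_less G e f \<Longrightarrow> e \<in> edges G \<and> f \<in> edges G"
  unfolding edge_less_def edge_ordered_graph_def order_on_defs
  by auto

lemma linear_order_on_Restr_subset:
  assumes "linear_order_on A r" and "B \<subseteq> A"
  shows "linear_order_on B (Restr r B)"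
  unfolding order_on_defs
proof (intro conjI)
  show "refl_on B (Restr r B)" "total_on B (Restr r B)"
    using assms by (auto simp: order_on_defs refl_on_def total_on_def subset_iff)
  show "trans (Restr r B)" "antisym (Restr r B)"
    using assms by (auto simp: order_on_defs trans_Restr antisym_def)
qed auto

section \<open>Embeddings and containment\<close>

definition eo_embeds :: "('a \<Rightarrow> 'b) \<Rightarrow> 'a eograph \<Rightarrow> 'b eograph \<Rightarrow> bool" where
  "eo_embeds \<phi> G K \<longleftrightarrow> inj_on \<phi> (verts G) \<and> \<phi> ` verts G \<subseteq> verts K \<and>
     (\<forall>e \<in> edges G. \<phi> ` e \<in> edges K) \<and>
     (\<forall>e f. edge_less G e f \<longrightarrow> edge_less K (\<phi> ` e) (\<phi> ` f))"

lemma eo_contains_embeds: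
  assumes "eo_contains K G" and G: "edge_ordered_graph G"
  shows "\<exists>\<phi>. eo_embeds \<phi> G K"
proof -
  obtain S f where S: "eo_subgraph S K" and f: "eo_isomorphism f G S"
    using assms unfolding eo_contains_def by blast
  have inj: "inj_on f (verts G)" and ver: "f ` verts G \<subseteq> verts K"
    using S f by (auto simp: eo_isomorphism_def eo_subgraph_def bij_betw_def)
  have ed: "f ` e \<in> edges S" if e: "e \<in> edges G" for e
  proof -
    obtain u v where uv: "e = {u, v}" using edge_ordered_graphD(4)[OF G e] by (meson card_2_iff)
    then have "u \<in> verts G" "v \<in> verts G" using edge_ordered_graphD(3)[OF G e] by auto
    then show ?thesis using f e uv unfolding eo_isomorphism_def by auto
  qed
  have "edge_less K (f ` e) (f ` g)" if less: "edge_less G e g" for e g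
  proof -
    have eg: "e \<in> edges G" "g \<in> edges G" using edge_less_edges[OF G less] by auto
    then have "(f ` e, f ` g) \<in> edge_le S"
      using f less unfolding eo_isomorphism_def edge_less_def by auto
    moreover have "f ` e \<noteq> f ` g"
      using inj_on_image_eq_iff[OF inj, of e g] edge_ordered_graphD(3)[OF G] eg less
      by (auto simp: edge_less_def)
    ultimately show ?thesis using S unfolding eo_subgraph_def edge_less_def by auto
  qed
  then have "eo_embeds f G K"
    using inj ver ed S unfolding eo_embeds_def eo_subgraph_def by blast
  then show ?thesis by blast
qed

text \<open>Both edge orders are linear, so a map that preserves the strict order also reflects it;
  hence the one-way condition in \<open>eo_embeds\<close> gives an isomorphism onto the
  image.\<close>

lemma eo_embeds_contains:
  assumes emb: "eo_embeds \<phi> G K" and G: "edge_ordered_graph G" and K: "edge_ordered_graph K"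
  shows "eo_contains K G"
proof -
  define S where "S = \<lparr>verts = \<phi> ` verts G, edges = (`) \<phi> ` edges G,
    edge_le = Restr (edge_le K) ((`) \<phi> ` edges G)\<rparr>"
  have inj: "inj_on \<phi> (verts G)" using emb by (simp add: eo_embeds_def)
  have sub: "(`) \<phi> ` edges G \<subseteq> edges K" using emb by (auto simp: eo_embeds_def)
  have "card (\<phi> ` e) = 2" if "e \<in> edges G" for e
    using card_image[OF inj_on_subset[OF inj edge_ordered_graphD(3)[OF G that]]]
      edge_ordered_graphD(4)[OF G that] by simp
  then have "simple_graph S"
    using edge_ordered_graphD(1,3)[OF G] by (auto simp: simple_graph_def S_def)
  moreover have "linear_order_on (edges S) (edge_le S)"
    using linear_order_on_Restr_subset[of "edges K" "edge_le K"] K sub by (simp add: edge_ordered_graph_def S_def)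
  ultimately have "eo_subgraph S K"
    using emb sub by (auto simp: eo_subgraph_def edge_ordered_graph_def S_def eo_embeds_def)
  moreover have "eo_isomorphism \<phi> G S"
    unfolding eo_isomorphism_def
  proof (intro conjI ballI)
    show "bij_betw \<phi> (verts G) (verts S)" using inj by (simp add: S_def bij_betw_def)
    fix u v assume "u \<in> verts G" "v \<in> verts G"
    then have "{\<phi> u, \<phi> v} = \<phi> ` e \<longleftrightarrow> {u, v} = e" if "e \<in> edges G" for e
      using inj_on_image_eq_iff[OF inj, of "{u, v}" e] edge_ordered_graphD(3)[OF G that] by simp
    then show "({u, v} \<in> edges G) = ({\<phi> u, \<phi> v} \<in> edges S)" by (auto simp: S_def)
  next
    fix e f assume ef: "e \<in> edges G" "f \<in> edges G"
    have "(e, f) \<in> edge_le G \<longleftrightarrow> e = f \<or> edge_less G e f"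
      using G ef by (auto simp: edge_less_def edge_ordered_graph_def order_on_defs refl_on_def)
    moreover have "(\<phi> ` e, \<phi> ` f) \<in> edge_le S \<longleftrightarrow> \<phi> ` e = \<phi> ` f \<or> edge_less K (\<phi> ` e) (\<phi> ` f)"
      using K ef sub
      by (auto simp: S_def edge_less_def edge_ordered_graph_def order_on_defs refl_on_def)
    moreover have "\<phi> ` e = \<phi> ` f \<longleftrightarrow> e = f"
      using inj_on_image_eq_iff[OF inj, of e f] edge_ordered_graphD(3)[OF G] ef by auto
    moreover have "edge_less G e f \<longleftrightarrow> edge_less K (\<phi> ` e) (\<phi> ` f)" if "e \<noteq> f"
      using edge_less_linear[OF G ef that] emb edge_less_asym[OF K]
      unfolding eo_embeds_def by blast
    ultimately show "((e, f) \<in> edge_le G) = ((\<phi> ` e, \<phi> ` f) \<in> edge_le S)" by blast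
  qed
  ultimately show ?thesis unfolding eo_contains_def by blast
qed

lemma eo_contains_iff:
  assumes "edge_ordered_graph G" and "edge_ordered_graph K"
  shows "eo_contains K G \<longleftrightarrow> (\<exists>\<phi>. eo_embeds \<phi> G K)"
  using assms eo_contains_embeds eo_embeds_contains by blast

lemma eo_contains_reverse:
  assumes "edge_ordered_graph G" and "edge_ordered_graph K"
  shows "eo_contains (reverse_eo K) (reverse_eo G) \<longleftrightarrow> eo_contains K G"
  using assms by (simp add: eo_contains_iff eo_embeds_def) blast

section \<open>The extremal number\<close>

text \<open>Reversing the host is an involution that keeps the numbers of vertices and edges and
  exchanges avoidance of \<open>G\<close> with avoidance of \<open>reverse_eo G\<close>.\<close>

lemma ex_eo_reverse:
  assumes G: "edge_ordered_graph G"
  shows "ex_eo n (reverse_eo G) = ex_eo n G"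
proof -
  have "{card (edges K) | K :: nat eograph. edge_ordered_graph K \<and> card (verts K) = n \<and> \<not> eo_contains K (reverse_eo G)}
      = {card (edges K) | K :: nat eograph. edge_ordered_graph K \<and> card (verts K) = n \<and> \<not> eo_contains K G}"
    (is "?A = ?B")
  proof
    have *: "eo_contains K (reverse_eo G) \<longleftrightarrow> eo_contains (reverse_eo K) G"
      if "edge_ordered_graph K" for K :: "nat eograph"
      using eo_contains_reverse[of G "reverse_eo K"] G that by simp
    show "?A \<subseteq> ?B"
    proof
      fix c assume "c \<in> ?A"
      then obtain K :: "nat eograph" where "c = card (edges (reverse_eo K))" "edge_ordered_graph (reverse_eo K)"
        "card (verts (reverse_eo K)) = n" "\<not> eo_contains (reverse_eo K) G"
        using * by auto
      then show "c \<in> ?B" by blast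
    qed
    show "?B \<subseteq> ?A"
    proof
      fix c assume "c \<in> ?B"
      then obtain K :: "nat eograph" where "c = card (edges (reverse_eo K))" "edge_ordered_graph (reverse_eo K)"
        "card (verts (reverse_eo K)) = n" "\<not> eo_contains (reverse_eo K) (reverse_eo G)"
        using eo_contains_reverse[OF G] by auto
      then show "c \<in> ?A" by blast
    qed
  qed
  then show ?thesis by (simp add: ex_eo_def)
qed

text \<open>\<open>Max\<close> gives a bound only on a finite set. The vertex sets range over all of
  \<open>nat\<close>, but edges are subsets of an \<open>n\<close>-element set, so there are at most
  \<open>2 ^ n\<close> of them.\<close>

lemma finite_ex_eo_set:
  "finite {card (edges K) | K :: nat eograph. edge_ordered_graph K \<and> card (verts K) = n \<and> \<not> eo_contains K G}"
proof (rule finite_subset)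
  show "{card (edges K) | K :: nat eograph. edge_ordered_graph K \<and> card (verts K) = n \<and> \<not> eo_contains K G}
      \<subseteq> {..2 ^ n}"
  proof clarsimp
    fix K :: "nat eograph" assume K: "edge_ordered_graph K"
    have "card (edges K) \<le> card (Pow (verts K))"
      by (rule card_mono) (use edge_ordered_graphD[OF K] in auto)
    then show "card (edges K) \<le> 2 ^ card (verts K)"
      using edge_ordered_graphD(1)[OF K] by (simp add: card_Pow)
  qed
qed simp

lemma ex_eo_ge:
  fixes K :: "nat eograph"
  assumes "edge_ordered_graph K" "card (verts K) = n" "\<not> eo_contains K G"
  shows "card (edges K) \<le> ex_eo n G"
  unfolding ex_eo_def by (rule Max_ge[OF finite_ex_eo_set]) (use assms in blast)

lemma ex_eo_le:
  assumes G: "edge_ordered_graph G" "edges G \<noteq> {}"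
    and le: "\<And>K :: nat eograph. edge_ordered_graph K \<Longrightarrow> card (verts K) = n \<Longrightarrow> \<not> eo_contains K G
      \<Longrightarrow> card (edges K) \<le> B"
  shows "ex_eo n G \<le> B"
proof -
  \<comment> \<open>The edgeless host avoids \<open>G\<close>, so the set in \<open>ex_eo\<close> is
    nonempty and its maximum is attained.\<close>
  define K :: "nat eograph" where "K = \<lparr>verts = {..<n}, edges = {}, edge_le = {}\<rparr>"
  have K: "edge_ordered_graph K"
    by (simp add: K_def edge_ordered_graph_def simple_graph_def order_on_defs refl_on_def trans_def antisym_def)
  have "\<not> eo_contains K G"
    using G(2) unfolding eo_contains_iff[OF G(1) K] eo_embeds_def by (auto simp: K_def)
  moreover have "card (verts K) = n" by (simp add: K_def)
  ultimately have "ex_eo n G \<in> {card (edges K) | K :: nat eograph.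
      edge_ordered_graph K \<and> card (verts K) = n \<and> \<not> eo_contains K G}"
    unfolding ex_eo_def using K by (intro Max_in[OF finite_ex_eo_set]) blast
  then show ?thesis using le by auto
qed

section \<open>Chromatic numbers and orders defined by labels\<close>

lemma ex_chromatic_colouring:
  fixes H :: "nat sgraph"
  assumes H: "simple_graph H"
  shows "\<exists>c. proper_colouring H (chromatic_number H) c"
  unfolding chromatic_number_def
proof (rule LeastI_ex)
  have "proper_colouring H (Suc (Max (verts H))) id"
    using H by (auto simp: proper_colouring_def simple_graph_def less_Suc_eq_le)
  then show "\<exists>k c. proper_colouring H k c" by blast
qed

lemma chromatic_number_ge_2:
  fixes H :: "nat sgraph"
  assumes H: "simple_graph H" and "edges H \<noteq> {}"
  shows "2 \<le> chromatic_number H"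
proof -
  obtain c where c: "proper_colouring H (chromatic_number H) c"
    using ex_chromatic_colouring[OF H] by blast
  obtain e where e: "e \<in> edges H" using assms by blast
  then obtain u v where uv: "e = {u, v}" using H by (auto simp: simple_graph_def card_2_iff)
  then have "u \<in> verts H" "v \<in> verts H" using H e by (auto simp: simple_graph_def)
  then have "c u < chromatic_number H" "c v < chromatic_number H" "c u \<noteq> c v"
    using c e uv by (auto simp: proper_colouring_def)
  then show ?thesis by linarith
qed

text \<open>Hosts get their order from a labelling of the edges; injectivity of \<open>l\<close> on
  the edges is what makes \<open>edge_le\<close> antisymmetric.\<close>

definition label_order :: "('a set \<Rightarrow> 'b::linorder) \<Rightarrow> 'a sgraph \<Rightarrow> 'a eograph" where
  "label_order l H = \<lparr>verts = verts H, edges = edges H,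
     edge_le = {(e, f). e \<in> edges H \<and> f \<in> edges H \<and> l e \<le> l f}\<rparr>"

lemma label_order_sel [simp]:
  "verts (label_order l H) = verts H" "edges (label_order l H) = edges H"
  by (simp_all add: label_order_def)

lemma edge_ordering_label_order:
  assumes "simple_graph H" and inj: "inj_on l (edges H)"
  shows "edge_ordering_of H (label_order l H)"
proof -
  have "linear_order_on (edges H) (edge_le (label_order l H))"
    unfolding order_on_defs label_order_def refl_on_def total_on_def trans_def antisym_def
    using inj by (auto simp: inj_on_def)
  moreover have "underlying (label_order l H) = H"
    by (simp add: sgraph.truncate_def)
  ultimately show ?thesis
    using assms(1) by (simp add: edge_ordering_of_def edge_ordered_graph_def simple_graph_def)
qed

lemma edge_less_label_order:
  assumes "inj_on l (edges H)"
  shows "edge_less (label_order l H) e f \<longleftrightarrow> e \<in> edges H \<and> f \<in> edges H \<and> l e < l f"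
  using assms by (auto simp: edge_less_def label_order_def inj_on_def less_le)

lemma ex_edge_ordering:
  fixes H :: "nat sgraph"
  assumes H: "simple_graph H"
  shows "\<exists>K. edge_ordering_of H K"
proof -
  have "finite (edges H)"
    using H by (intro finite_subset[of "edges H" "Pow (verts H)"]) (auto simp: simple_graph_def)
  then obtain l :: "nat set \<Rightarrow> nat" where "inj_on l (edges H)"
    using finite_imp_inj_to_nat_seg by metis
  then show ?thesis using edge_ordering_label_order[OF H] by blast
qed

text \<open>\<open>H\<close> has at least one edge-ordering, and the copy of \<open>G\<close> in it
  forces \<open>H\<close> to have an edge.\<close>

lemma order_chromatic_number_ge_2:
  assumes G: "edge_ordered_graph G" "edges G \<noteq> {}" and H: "simple_graph (H :: nat sgraph)"
    and all: "\<forall>K. edge_ordering_of H K \<longrightarrow> eo_contains K G"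
  shows "2 \<le> chromatic_number H"
proof -
  obtain K where K: "edge_ordering_of H K" using ex_edge_ordering[OF H] by blast
  then obtain \<phi> where "eo_embeds \<phi> G K" using all eo_contains_embeds[OF _ G(1)] by blast
  moreover have "edges K = edges H" using K by (auto simp: edge_ordering_of_def sgraph.truncate_def)
  ultimately have "edges H \<noteq> {}" using G(2) by (auto simp: eo_embeds_def)
  then show ?thesis using chromatic_number_ge_2[OF H] by blast
qed

text \<open>The infimum of a nonempty set in \<open>enat\<close> is attained, which yields a single
  graph \<open>H\<close> to work with.\<close>

lemma order_chromatic_number_2D:
  assumes "order_chromatic_number G = 2"
  obtains H :: "nat sgraph" where "simple_graph H" "chromatic_number H = 2"
    "\<And>K. edge_ordering_of H K \<Longrightarrow> eo_contains K G"
proof -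
  let ?S = "{enat (chromatic_number H) | H :: nat sgraph.
     simple_graph H \<and> (\<forall>K. edge_ordering_of H K \<longrightarrow> eo_contains K G)}"
  have "?S \<noteq> {}"
  proof
    assume "?S = {}"
    then show False using assms unfolding order_chromatic_number_def by (simp add: Inf_enat_def)
  qed
  then have "Inf ?S \<in> ?S" by (metis (no_types, lifting) ex_in_conv wellorder_InfI)
  then obtain H :: "nat sgraph" where "simple_graph H" "enat (chromatic_number H) = 2"
     "\<forall>K. edge_ordering_of H K \<longrightarrow> eo_contains K G"
    using assms unfolding order_chromatic_number_def by auto
  then show ?thesis using that by (metis enat.inject numeral_eq_enat)
qed

section \<open>Splitting the vertices into rows and columns\<close>

text \<open>\<open>A\<close> is the set of rows and its complement the set of columns; the edges
  within one row may come in any order. Ranks are integers so that negating them gives the same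
  structure on the reverse.\<close>

locale row_split =
  fixes G :: "'a eograph" and A :: "'a set" and rk :: "'a \<Rightarrow> int"
  assumes eog: "edge_ordered_graph G"
    and edge_split: "e \<in> edges G \<Longrightarrow> \<exists>a b. a \<in> A \<and> b \<notin> A \<and> e = {a, b}"
    and A_verts: "A \<subseteq> verts G"
    and inj_rk: "inj_on rk A"
    and rows_less: "\<lbrakk>a \<in> A; a' \<in> A; {a, b} \<in> edges G; {a', b'} \<in> edges G; rk a < rk a'\<rbrakk>
      \<Longrightarrow> edge_less G {a, b} {a', b'}"
begin

definition nb :: "'a \<Rightarrow> 'a \<Rightarrow> bool" where
  "nb a b \<longleftrightarrow> a \<in> A \<and> {a, b} \<in> edges G"

lemma nbD:
  assumes "nb a b"
  shows "a \<in> A" "b \<notin> A" "{a, b} \<in> edges G" "b \<in> verts G" "a \<noteq> b"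
proof -
  show ab: "a \<in> A" "{a, b} \<in> edges G" using assms by (auto simp: nb_def)
  show b: "b \<notin> A" using edge_split[OF ab(2)] ab(1) by (auto simp: doubleton_eq_iff)
  show "b \<in> verts G" using edge_ordered_graphD(3)[OF eog ab(2)] by auto
  show "a \<noteq> b" using ab b by auto
qed

lemma edge_nb: "e \<in> edges G \<Longrightarrow> \<exists>a b. nb a b \<and> e = {a, b}"
  using edge_split by (metis nb_def)

lemma nb_edge_eq:
  "nb a b \<Longrightarrow> nb a' b' \<Longrightarrow> {a, b} = {a', b'} \<longleftrightarrow> a = a' \<and> b = b'"
  using nbD(1,2) by (metis doubleton_eq_iff)

lemma nb_less: "nb a b \<Longrightarrow> nb a' b' \<Longrightarrow> rk a < rk a' \<Longrightarrow> edge_less G {a, b} {a', b'}"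
  using rows_less by (simp add: nb_def)

lemma nb_rk_le: "nb a b \<Longrightarrow> nb a' b' \<Longrightarrow> edge_less G {a, b} {a', b'} \<Longrightarrow> rk a \<le> rk a'"
  using nb_less edge_less_asym[OF eog] by (metis not_le)

lemma rk_eq: "nb a b \<Longrightarrow> nb a' b' \<Longrightarrow> rk a = rk a' \<longleftrightarrow> a = a'"
  using inj_rk nbD(1) by (metis inj_on_eq_iff)

end

lemma row_split_reverse:
  assumes "row_split G A rk"
  shows "row_split (reverse_eo G) A (\<lambda>v. - rk v)"
proof -
  interpret row_split G A rk by fact
  show ?thesis
    by unfold_locales (use eog edge_split A_verts inj_rk rows_less in \<open>auto simp: inj_on_def\<close>)
qed

lemma row_split_nb_reverse:
  assumes "row_split G A rk"
  shows "row_split.nb (reverse_eo G) A = row_split.nb G A"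
  using row_split.nb_def[OF assms] row_split.nb_def[OF row_split_reverse[OF assms]] by (intro ext) simp

text \<open>A 2-coloured \<open>H\<close> all of whose edge-orderings contain \<open>G\<close> is
  ordered lexicographically, by the end of colour 0 and then by the other end. The rows are the
  vertices of \<open>G\<close> sent to colour 0, ranked by their images.\<close>

lemma order_chromatic_number_2_row_split:
  assumes G: "edge_ordered_graph G" and chi: "order_chromatic_number G = 2"
  shows "\<exists>A rk. row_split G A rk"
proof -
  obtain H :: "nat sgraph" where H: "simple_graph H" and "chromatic_number H = 2"
    and all: "\<And>K. edge_ordering_of H K \<Longrightarrow> eo_contains K G"
    using order_chromatic_number_2D[OF chi] by blast
  then obtain c where c: "proper_colouring H 2 c" using ex_chromatic_colouring by metis
  define l where "l e = (THE u. u \<in> e \<and> c u = 0, THE u. u \<in> e \<and> c u \<noteq> 0)" for e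
  have l: "l {u, v} = (u, v)" if "c u = 0" "c v \<noteq> 0" for u v
    using that by (auto simp: l_def intro!: the_equality)
  have ex: "\<exists>u v. e = {u, v} \<and> c u = 0 \<and> c v \<noteq> 0" if e: "e \<in> edges H" for e
  proof -
    obtain u v where uv: "e = {u, v}" using H e by (auto simp: simple_graph_def card_2_iff)
    then have "u \<in> verts H" "v \<in> verts H" using H e by (auto simp: simple_graph_def)
    then have "c u < 2" "c v < 2" "c u \<noteq> c v" using c e uv by (auto simp: proper_colouring_def)
    then consider "c u = 0" "c v \<noteq> 0" | "c v = 0" "c u \<noteq> 0" by linarith
    then show ?thesis using uv by cases (auto simp: insert_commute)
  qed
  have inj: "inj_on l (edges H)"
  proof (rule inj_onI)
    fix e f assume ef: "e \<in> edges H" "f \<in> edges H" "l e = l f"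
    obtain u v u' v' where "e = {u, v}" "c u = 0" "c v \<noteq> 0" "f = {u', v'}" "c u' = 0" "c v' \<noteq> 0"
      using ex ef by metis
    then show "e = f" using l ef(3) by simp
  qed
  define K where "K = label_order l H"
  obtain \<phi> where \<phi>: "eo_embeds \<phi> G K"
    using all[OF edge_ordering_label_order[OF H inj]] eo_contains_embeds[OF _ G] K_def by blast
  define A where "A = {v \<in> verts G. c (\<phi> v) = 0}"
  have inj\<phi>: "inj_on \<phi> (verts G)" using \<phi> by (simp add: eo_embeds_def)
  have ed: "\<phi> ` e \<in> edges H" if "e \<in> edges G" for e
    using \<phi> that by (simp add: eo_embeds_def K_def)
  have split: "\<exists>a b. a \<in> A \<and> b \<notin> A \<and> e = {a, b}" if e: "e \<in> edges G" for e
  proof -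
    obtain u v where uv: "e = {u, v}" using edge_ordered_graphD(4)[OF G e] by (meson card_2_iff)
    then have mem: "u \<in> verts G" "v \<in> verts G" using edge_ordered_graphD(3)[OF G e] by auto
    obtain x y where "{\<phi> u, \<phi> v} = {x, y}" "c x = 0" "c y \<noteq> 0"
      using ex[OF ed[OF e]] uv by auto
    then consider "c (\<phi> u) = 0" "c (\<phi> v) \<noteq> 0" | "c (\<phi> v) = 0" "c (\<phi> u) \<noteq> 0"
      by (metis doubleton_eq_iff)
    then show ?thesis using uv mem unfolding A_def by cases (auto simp: insert_commute)
  qed
  have "row_split G A (\<lambda>v. int (\<phi> v))"
  proof
    show "inj_on (\<lambda>v. int (\<phi> v)) A"
      using inj\<phi> by (auto simp: inj_on_def A_def)
  next
    fix a a' b b'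
    assume a: "a \<in> A" "a' \<in> A" and e: "{a, b} \<in> edges G" "{a', b'} \<in> edges G"
      and less: "int (\<phi> a) < int (\<phi> a')"
    have "c (\<phi> y) \<noteq> 0" if "x \<in> A" "{x, y} \<in> edges G" for x y
      using c ed[OF that(2)] that(1) unfolding A_def proper_colouring_def by force
    then have lab: "l (\<phi> ` {x, y}) = (\<phi> x, \<phi> y)" if "x \<in> A" "{x, y} \<in> edges G" for x y
      using l that by (simp add: A_def)
    have "edge_less K (\<phi> ` {a', b'}) (\<phi> ` {a, b})" if "edge_less G {a', b'} {a, b}"
      using \<phi> that unfolding eo_embeds_def by blast
    then have "\<not> edge_less G {a', b'} {a, b}"
      using less lab[OF a(1) e(1)] lab[OF a(2) e(2)]
      unfolding K_def edge_less_label_order[OF inj] by (auto simp: less_prod_def)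
    moreover have "l (\<phi> ` {a, b}) \<noteq> l (\<phi> ` {a', b'})"
      using lab[OF a(1) e(1)] lab[OF a(2) e(2)] less by auto
    then have "{a, b} \<noteq> {a', b'}" by metis
    ultimately show "edge_less G {a, b} {a', b'}" using edge_less_linear[OF G e] by blast
  qed (use G split in \<open>auto simp: A_def\<close>)
  then show ?thesis by blast
qed

text \<open>If every edge-ordering of the complete bipartite graph with parts of sizes
  \<open>n div 2\<close> and \<open>n - n div 2\<close> contained \<open>G\<close>, the order
  chromatic number would be 2. So one of them avoids \<open>G\<close>.\<close>

lemma ex_eo_quadratic:
  fixes G :: "'a eograph"
  assumes G: "edge_ordered_graph G" "edges G \<noteq> {}" and chi: "order_chromatic_number G \<noteq> 2"
    and n: "n \<ge> 2"
  shows "(n div 2) * (n - n div 2) \<le> ex_eo n G"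
proof -
  define m where "m = n div 2"
  have m: "0 < m" "m < n" using n by (auto simp: m_def)
  define e where "e p = {fst p, snd p}" for p :: "nat \<times> nat"
  define H :: "nat sgraph" where "H = \<lparr>verts = {..<n}, edges = e ` ({..<m} \<times> {m..<n})\<rparr>"
  have inj: "inj_on e ({..<m} \<times> {m..<n})"
    by (auto simp: inj_on_def e_def doubleton_eq_iff)
  have H: "simple_graph H" using m by (auto simp: simple_graph_def H_def e_def card_insert_if)
  have col: "proper_colouring H 2 (\<lambda>v. if v < m then 0 else 1)"
    by (auto simp: proper_colouring_def H_def e_def doubleton_eq_iff)
  have "chromatic_number H \<le> 2" unfolding chromatic_number_def by (rule Least_le) (use col in blast)
  have "\<exists>K. edge_ordering_of H K \<and> \<not> eo_contains K G"
  proof (rule ccontr)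
    assume "\<not> ?thesis"
    then have all: "\<forall>K. edge_ordering_of H K \<longrightarrow> eo_contains K G" by blast
    have "chromatic_number H = 2"
      using order_chromatic_number_ge_2[OF G H all] \<open>chromatic_number H \<le> 2\<close> by simp
    then have "order_chromatic_number G \<le> 2"
      unfolding order_chromatic_number_def using H all
      by (intro Inf_lower) (auto simp: numeral_eq_enat intro!: exI[of _ H])
    moreover have "2 \<le> order_chromatic_number G"
      unfolding order_chromatic_number_def
      by (rule Inf_greatest) (use order_chromatic_number_ge_2[OF G] in \<open>auto simp: numeral_eq_enat\<close>)
    ultimately show False using chi by simp
  qed
  then obtain K where K: "edge_ordering_of H K" "\<not> eo_contains K G" by blast
  have "verts K = verts H" "edges K = edges H"
    using K(1) by (auto simp: edge_ordering_of_def sgraph.truncate_def)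
  moreover have "card (edges H) = m * (n - m)"
    by (simp add: H_def card_image[OF inj] card_cartesian_product)
  ultimately show ?thesis
    using ex_eo_ge[of K n G] K by (simp add: edge_ordering_of_def H_def m_def)
qed

section \<open>Bipartite hosts\<close>

text \<open>The two sides of a host are the even and the odd numbers, so that index pairs below
  \<open>n div 2\<close> give vertices below \<open>n\<close>.\<close>

definition bip_edge :: "nat \<times> nat \<Rightarrow> nat set" where
  "bip_edge p = {2 * fst p, 2 * snd p + 1}"

lemma bip_edge_eq_iff: "bip_edge p = bip_edge q \<longleftrightarrow> p = q"
proof -
  have "even (2 * x)" "odd (2 * x + 1)" for x :: nat by auto
  then have "2 * x \<noteq> 2 * y + 1" for x y :: nat by metis
  then show ?thesis by (auto simp: bip_edge_def doubleton_eq_iff prod_eq_iff)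
qed

definition bip_host :: "nat \<Rightarrow> (nat \<times> nat) set \<Rightarrow> (nat \<times> nat \<Rightarrow> 'b::linorder) \<Rightarrow> nat eograph" where
  "bip_host n R l = label_order (\<lambda>e. l (inv bip_edge e)) \<lparr>verts = {..<n}, edges = bip_edge ` R\<rparr>"

lemma inv_bip_edge [simp]: "inv bip_edge (bip_edge p) = p"
  by (simp add: bip_edge_eq_iff inj_def)

lemma bip_host_verts [simp]: "verts (bip_host n R l) = {..<n}"
  and bip_host_edges [simp]: "edges (bip_host n R l) = bip_edge ` R"
  by (simp_all add: bip_host_def)

lemma card_bip_host: "card (edges (bip_host n R l)) = card R"
  by (simp add: card_image inj_on_def bip_edge_eq_iff)

lemma edge_less_bip_host:
  assumes "inj_on l R"
  shows "edge_less (bip_host n R l) (bip_edge p) (bip_edge q) \<longleftrightarrow> p \<in> R \<and> q \<in> R \<and> l p < l q"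
proof -
  have "inj_on (\<lambda>e. l (inv bip_edge e)) (bip_edge ` R)"
    using assms by (auto simp: inj_on_def bip_edge_eq_iff)
  then show ?thesis
    unfolding bip_host_def by (subst edge_less_label_order) (auto simp: bip_edge_eq_iff)
qed

lemma edge_ordered_bip_host:
  assumes "inj_on l R" and "R \<subseteq> {..<n div 2} \<times> {..<n div 2}"
  shows "edge_ordered_graph (bip_host n R l)"
proof -
  have "inj_on (\<lambda>e. l (inv bip_edge e)) (bip_edge ` R)"
    using assms by (auto simp: inj_on_def bip_edge_eq_iff)
  moreover have "bip_edge p \<subseteq> {..<n} \<and> card (bip_edge p) = 2" if "p \<in> R" for p
  proof -
    have "fst p < n div 2" "snd p < n div 2" using that assms(2) by auto
    moreover have "2 * fst p \<noteq> 2 * snd p + 1" by presburger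
    ultimately show ?thesis unfolding bip_edge_def by auto
  qed
  then have "simple_graph \<lparr>verts = {..<n}, edges = bip_edge ` R\<rparr>"
    by (auto simp: simple_graph_def)
  ultimately show ?thesis
    using edge_ordering_label_order unfolding bip_host_def edge_ordering_of_def by force
qed

context row_split
begin

text \<open>An embedding into a bipartite host, read on indices. A row and a column may receive the
  same index, hence the two separate injectivity conditions.\<close>

definition row_map :: "('a \<Rightarrow> nat) \<Rightarrow> (nat \<times> nat) set \<Rightarrow> (nat \<times> nat \<Rightarrow> 'b::linorder) \<Rightarrow> bool" where
  "row_map g R l \<longleftrightarrow> inj_on g A \<and> inj_on g (verts G - A) \<and>
     (\<forall>a b. nb a b \<longrightarrow> (g a, g b) \<in> R) \<and>
     (\<forall>a b a' b'. nb a b \<longrightarrow> nb a' b' \<longrightarrow> edge_less G {a, b} {a', b'} \<longrightarrow> l (g a, g b) < l (g a', g b'))"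

text \<open>A connected pattern has its rows on one side of a bipartite host; the second
  alternative is the host with its two sides exchanged.\<close>

lemma bip_host_row_map:
  assumes conn: "connected_graph (underlying G)"
    and inj: "inj_on l R" and sub: "R \<subseteq> {..<n div 2} \<times> {..<n div 2}"
    and cont: "eo_contains (bip_host n R l) G"
  shows "\<exists>g. row_map g R l \<or> row_map g (R\<inverse>) (l \<circ> prod.swap)"
proof -
  obtain \<phi> where \<phi>: "eo_embeds \<phi> G (bip_host n R l)"
    using eo_contains_embeds[OF cont eog] by blast
  define g where "g v = \<phi> v div 2" for v
  \<comment> \<open>\<open>s v\<close> says that \<open>\<phi>\<close> sends rows to even and
    columns to odd numbers at \<open>v\<close>. Both parity and membership in \<open>A\<close> flip
    along an edge, so \<open>s\<close> is constant on the connected graph.\<close>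
  define s where "s v \<longleftrightarrow> (even (\<phi> v) \<longleftrightarrow> v \<in> A)" for v
  have img: "\<exists>p \<in> R. {\<phi> u, \<phi> v} = bip_edge p" if "{u, v} \<in> edges G" for u v
  proof -
    have "\<phi> ` {u, v} \<in> bip_edge ` R" using \<phi> that unfolding eo_embeds_def by (metis bip_host_edges)
    then show ?thesis by auto
  qed
  have par: "even (\<phi> u) \<longleftrightarrow> odd (\<phi> v)" if e: "{u, v} \<in> edges G" for u v
    using img[OF e] by (auto simp: bip_edge_def doubleton_eq_iff)
  have step: "s u \<longleftrightarrow> s v" if "{u, v} \<in> edges G" for u v
    using par[OF that] edge_split[OF that] unfolding s_def by (auto simp: doubleton_eq_iff)
  have reach: "s u \<longleftrightarrow> s v" if "(u, v) \<in> (adjacency (underlying G))\<^sup>*" for u v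
    using that by (induction rule: rtrancl_induct) (auto simp: adjacency_def step)
  obtain r where r: "r \<in> verts G" using conn by (auto simp: connected_graph_def)
  have const: "s v \<longleftrightarrow> s r" if "v \<in> verts G" for v
    using reach that r conn unfolding connected_graph_def by (metis verts_underlying)
  have inj\<phi>: "inj_on \<phi> (verts G)" using \<phi> by (simp add: eo_embeds_def)
  have gi: "inj_on g S" if S: "S \<subseteq> verts G" and par': "\<And>u v. u \<in> S \<Longrightarrow> v \<in> S \<Longrightarrow> even (\<phi> u) \<longleftrightarrow> even (\<phi> v)" for S
  proof (rule inj_onI)
    fix u v assume uv: "u \<in> S" "v \<in> S" "g u = g v"
    then have "\<phi> u = \<phi> v" using par'[OF uv(1,2)] unfolding g_def
      by (metis dvd_mult_div_cancel odd_two_times_div_two_succ)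
    then show "u = v" using inj\<phi> uv S by (auto simp: inj_on_def)
  qed
  have gA: "inj_on g A" by (rule gi[OF A_verts]) (use const A_verts s_def in blast)
  have gB: "inj_on g (verts G - A)" by (rule gi) (use const s_def in auto)
  show ?thesis
  proof (cases "s r")
    case True
    have im: "\<phi> ` {a, b} = bip_edge (g a, g b) \<and> (g a, g b) \<in> R" if ab: "nb a b" for a b
    proof -
      have "even (\<phi> a)" using const[of a] True nbD(1)[OF ab] A_verts by (auto simp: s_def)
      moreover obtain p where p: "p \<in> R" "{\<phi> a, \<phi> b} = bip_edge p" using img nbD(3)[OF ab] by blast
      ultimately have "\<phi> a = 2 * fst p" "\<phi> b = 2 * snd p + 1"
        by (auto simp: bip_edge_def doubleton_eq_iff)
      then have "(g a, g b) = p" by (simp add: g_def)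
      then show ?thesis using p by simp
    qed
    have "l (g a, g b) < l (g a', g b')"
      if "nb a b" "nb a' b'" "edge_less G {a, b} {a', b'}" for a b a' b'
      using \<phi> that im[OF that(1)] im[OF that(2)] edge_less_bip_host[OF inj]
      unfolding eo_embeds_def by metis
    then have "row_map g R l" using gA gB im by (auto simp: row_map_def)
    then show ?thesis by blast
  next
    case False
    have im: "\<phi> ` {a, b} = bip_edge (g b, g a) \<and> (g b, g a) \<in> R" if ab: "nb a b" for a b
    proof -
      have "odd (\<phi> a)" using const[of a] False nbD(1)[OF ab] A_verts by (auto simp: s_def)
      moreover obtain p where p: "p \<in> R" "{\<phi> a, \<phi> b} = bip_edge p" using img nbD(3)[OF ab] by blast
      ultimately have "\<phi> b = 2 * fst p" "\<phi> a = 2 * snd p + 1"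
        by (auto simp: bip_edge_def doubleton_eq_iff)
      then have "(g b, g a) = p" by (simp add: g_def)
      then show ?thesis using p by simp
    qed
    have "l (g b, g a) < l (g b', g a')"
      if "nb a b" "nb a' b'" "edge_less G {a, b} {a', b'}" for a b a' b'
      using \<phi> that im[OF that(1)] im[OF that(2)] edge_less_bip_host[OF inj]
      unfolding eo_embeds_def by metis
    then have "row_map g (R\<inverse>) (l \<circ> prod.swap)" using gA gB im by (auto simp: row_map_def)
    then show ?thesis by blast
  qed
qed

end

section \<open>The host with differences that are powers of two\<close>

definition pow2_rel :: "nat \<Rightarrow> (nat \<times> nat) set" where
  "pow2_rel m = {(x, y). y < m \<and> (\<exists>k. y = x + 2 ^ k)}"

lemma pow2_rel_subset: "pow2_rel m \<subseteq> {..<m} \<times> {..<m}"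
  by (auto simp: pow2_rel_def)

text \<open>For \<open>k < K\<close> the difference \<open>2 ^ k\<close> is at most
  \<open>m div 2\<close>, so each \<open>x < m - m div 2\<close> begins an edge for each of the
  \<open>K\<close> exponents.\<close>

lemma card_pow2_rel:
  assumes "2 ^ K \<le> m"
  shows "K * (m - m div 2) \<le> card (pow2_rel m)"
proof -
  define f where "f p = (snd p, snd p + 2 ^ fst p)" for p :: "nat \<times> nat"
  have inj: "inj_on f ({..<K} \<times> {..<m - m div 2})" by (auto simp: inj_on_def f_def)
  have "f ` ({..<K} \<times> {..<m - m div 2}) \<subseteq> pow2_rel m"
  proof (rule image_subsetI)
    fix p assume "p \<in> {..<K} \<times> {..<m - m div 2}"
    then obtain k x where p: "p = (k, x)" "k < K" "x < m - m div 2" by (cases p) auto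
    have "2 * (2::nat) ^ k \<le> 2 ^ K"
      using \<open>k < K\<close> power_increasing[of "Suc k" K "2::nat"] by simp
    then have "2 ^ k \<le> m div 2" using assms by linarith
    then show "f p \<in> pow2_rel m" using p by (auto simp: f_def pow2_rel_def)
  qed
  then have "card (f ` ({..<K} \<times> {..<m - m div 2})) \<le> card (pow2_rel m)"
    by (intro card_mono) (rule finite_subset[OF pow2_rel_subset], auto)
  then show ?thesis by (simp add: card_image[OF inj] card_cartesian_product)
qed

text \<open>The signs \<open>s\<close> and \<open>t\<close> range over 1 and -1. The second index is
  the leading one; exchanging the sides of the host makes it the row index.\<close>

definition lex_label :: "int \<Rightarrow> int \<Rightarrow> nat \<times> nat \<Rightarrow> int \<times> int" where
  "lex_label s t p = (s * int (snd p), t * int (fst p))"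

text \<open>The second component only breaks ties, to make the label injective.\<close>

definition sum_label :: "nat \<times> nat \<Rightarrow> nat \<times> nat" where
  "sum_label p = (fst p + snd p, fst p)"

lemma inj_lex_label: "s \<noteq> 0 \<Longrightarrow> t \<noteq> 0 \<Longrightarrow> inj_on (lex_label s t) R"
  by (auto simp: inj_on_def lex_label_def)

lemma inj_sum_label: "inj_on sum_label R"
  by (auto simp: inj_on_def sum_label_def)

text \<open>Both \<open>q\<close> and \<open>r\<close> are below \<open>s\<close>, so
  \<open>2 ^ q\<close> and \<open>2 ^ r\<close> are at most half of \<open>2 ^ s\<close>. Then
  \<open>v = c + 2 ^ s - 2 ^ q\<close> is at least \<open>c + 2 ^ r = y2\<close>, although
  \<open>y2 > y1 > v\<close>.\<close>

lemma pow2_configuration: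
  fixes c v y1 y2 y3 :: nat
  assumes "c < v" "y1 < y2" "y2 < y3"
    and "y1 = v + 2 ^ p" "y3 = v + 2 ^ q" "y2 = c + 2 ^ r" "y3 = c + 2 ^ s"
  shows False
proof -
  have "(2::nat) ^ q < 2 ^ s" "(2::nat) ^ r < 2 ^ s" using assms by linarith+
  then have "Suc q \<le> s" "Suc r \<le> s" by (simp_all add: Suc_le_eq)
  then have "2 * (2::nat) ^ q \<le> 2 ^ s" "2 * (2::nat) ^ r \<le> 2 ^ s"
    using power_increasing[of _ s "2::nat"] by (metis power_Suc one_le_numeral)+
  then show False using assms by linarith
qed

context row_split
begin

lemma row_map_less_iff:
  assumes g: "row_map g R l" and nb: "nb x y" "nb x' y'"
  shows "edge_less G {x, y} {x', y'} \<longleftrightarrow> l (g x, g y) < l (g x', g y')"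
proof
  assume less: "l (g x, g y) < l (g x', g y')"
  have "\<not> edge_less G {x', y'} {x, y}"
  proof
    assume "edge_less G {x', y'} {x, y}"
    then have "l (g x', g y') < l (g x, g y)" using g nb unfolding row_map_def by blast
    then show False using less by simp
  qed
  moreover have "{x, y} \<noteq> {x', y'}" using nb_edge_eq[OF nb] less by auto
  ultimately show "edge_less G {x, y} {x', y'}"
    using edge_less_linear[OF eog nbD(3)[OF nb(1)] nbD(3)[OF nb(2)]] by blast
next
  assume "edge_less G {x, y} {x', y'}"
  then show "l (g x, g y) < l (g x', g y')" using g nb unfolding row_map_def by blast
qed

text \<open>A row that is extreme between two neighbouring rows of a path, together with the two
  outer edges, is a path \<open>1342\<close> or \<open>1432\<close>, or the reverse of one: two of its columns
  compare as \<open>c < v\<close> in one of the lexicographic hosts, which is then \<open>pow2_configuration\<close>.\<close>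

lemma no_extreme_row:
  assumes hosts: "\<And>s t. s \<in> {1, -1} \<Longrightarrow> t \<in> {1, -1} \<Longrightarrow>
      \<exists>m g. row_map g (pow2_rel m) (lex_label s t) \<or>
        row_map g ((pow2_rel m)\<inverse>) (lex_label s t \<circ> prod.swap)"
    and nb: "nb a v" "nb a' v" "nb a' c" "nb a'' c" and "v \<noteq> c"
    and s: "s \<in> {1, -1}" and less: "s * rk a < s * rk a''" "s * rk a'' < s * rk a'"
  shows False
proof -
  have "{a', v} \<noteq> {a', c}" using nb_edge_eq[OF nb(2,3)] \<open>v \<noteq> c\<close> by simp
  then consider (vc) "edge_less G {a', v} {a', c}" | (cv) "edge_less G {a', c} {a', v}"
    using edge_less_linear[OF eog nbD(3)[OF nb(2)] nbD(3)[OF nb(3)]] by blast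
  \<comment> \<open>The sign \<open>t\<close> is chosen so that, in the host with its sides
    exchanged, the two edges at \<open>a'\<close> give \<open>g c < g v\<close>.\<close>
  then obtain t :: int where t: "t \<in> {1, -1}"
    and tl: "edge_less G {a', v} {a', c} \<and> t = -1 \<or> edge_less G {a', c} {a', v} \<and> t = 1"
    by cases auto
  have ne: "a \<noteq> a''" "a'' \<noteq> a'" using less by auto
  have e1: "s = 1 \<and> edge_less G {a, v} {a'', c} \<or> s = -1 \<and> edge_less G {a'', c} {a, v}"
    using s less nb_less[OF nb(1,4)] nb_less[OF nb(4,1)] by auto
  have e2: "s = 1 \<and> edge_less G {a'', c} {a', v} \<or> s = -1 \<and> edge_less G {a', v} {a'', c}"
    using s less nb_less[OF nb(4,2)] nb_less[OF nb(2,4)] by auto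
  have e3: "s = 1 \<and> edge_less G {a'', c} {a', c} \<or> s = -1 \<and> edge_less G {a', c} {a'', c}"
    using s less nb_less[OF nb(4,3)] nb_less[OF nb(3,4)] by auto
  obtain m g where "row_map g (pow2_rel m) (lex_label s t) \<or>
        row_map g ((pow2_rel m)\<inverse>) (lex_label s t \<circ> prod.swap)"
    using hosts[OF s t] by blast
  then show False
  proof
    \<comment> \<open>Here columns lead the label. In the direction given by \<open>s\<close>, the
      edge \<open>a''c\<close> lies between \<open>av\<close> and \<open>a'v\<close>, which squeezes
      \<open>c\<close> onto the image of \<open>v\<close>.\<close>
    assume g: "row_map g (pow2_rel m) (lex_label s t)"
    have lab: "edge_less G {x, y} {x', y'} \<Longrightarrow> lex_label s t (g x, g y) < lex_label s t (g x', g y')"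
      if "nb x y" "nb x' y'" for x y x' y'
      using row_map_less_iff[OF g that] by simp
    have "g v \<le> g c" using e1 lab[OF nb(1,4)] lab[OF nb(4,1)] by (auto simp: lex_label_def less_prod_def)
    moreover have "g c \<le> g v" using e2 lab[OF nb(4,2)] lab[OF nb(2,4)] by (auto simp: lex_label_def less_prod_def)
    ultimately have "v = c" using g nbD(2,4)[OF nb(1)] nbD(2,4)[OF nb(4)]
      unfolding row_map_def by (auto dest: inj_onD)
    then show False using \<open>v \<noteq> c\<close> by simp
  next
    \<comment> \<open>Here rows lead the label, so the images of \<open>a\<close>,
      \<open>a''\<close>, \<open>a'\<close> increase. They are the \<open>y1\<close>,
      \<open>y2\<close>, \<open>y3\<close> of \<open>pow2_configuration\<close>.\<close>
    assume g: "row_map g ((pow2_rel m)\<inverse>) (lex_label s t \<circ> prod.swap)"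
    have lab: "edge_less G {x, y} {x', y'} \<Longrightarrow> lex_label s t (g y, g x) < lex_label s t (g y', g x')"
      if "nb x y" "nb x' y'" for x y x' y'
      using row_map_less_iff[OF g that] by simp
    have gi: "g x \<noteq> g y" if "x \<in> A" "y \<in> A" "x \<noteq> y" for x y
      using g that unfolding row_map_def by (auto dest: inj_onD)
    have pow: "\<exists>k. g x = g y + 2 ^ k" if "nb x y" for x y
      using g that unfolding row_map_def pow2_rel_def by auto
    have "g a \<le> g a''" using e1 lab[OF nb(1,4)] lab[OF nb(4,1)] by (auto simp: lex_label_def less_prod_def)
    then have "g a < g a''" using gi[of a a''] nbD(1) nb ne by force
    moreover have "g a'' \<le> g a'" using e3 lab[OF nb(4,3)] lab[OF nb(3,4)] by (auto simp: lex_label_def less_prod_def)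
    then have "g a'' < g a'" using gi[of a'' a'] nbD(1) nb ne by force
    moreover have "g c < g v" using tl lab[OF nb(2,3)] lab[OF nb(3,2)] by (auto simp: lex_label_def less_prod_def)
    ultimately show False using pow2_configuration pow nb by metis
  qed
qed

text \<open>What the host labelled \<open>x + y\<close> imposes when the rows are its lower ends;
  \<open>early_neighbours\<close> is the dual, when the rows are its upper ends.\<close>

definition late_neighbours :: bool where
  "late_neighbours \<longleftrightarrow> (\<forall>a a' b d. nb a b \<longrightarrow> nb a d \<longrightarrow> nb a' b \<longrightarrow>
     edge_less G {a, b} {a, d} \<longrightarrow> edge_less G {a', b} {a, d})"

definition early_neighbours :: bool where
  "early_neighbours \<longleftrightarrow> (\<forall>a a' b d. nb a b \<longrightarrow> nb a d \<longrightarrow> nb a' b \<longrightarrow>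
     edge_less G {a, d} {a, b} \<longrightarrow> edge_less G {a, d} {a', b})"

text \<open>With rows as lower ends, \<open>ab\<close> before \<open>ad\<close> means that
  \<open>g d - g a\<close> is at least twice \<open>g b - g a\<close>, so \<open>g a + g d\<close>
  is at least \<open>2 * g b\<close>, which exceeds \<open>g a' + g b\<close>. The other side is the
  mirror image.\<close>

lemma sum_host_neighbours:
  assumes "row_map g (pow2_rel m) sum_label \<or> row_map g ((pow2_rel m)\<inverse>) (sum_label \<circ> prod.swap)"
  shows "late_neighbours \<or> early_neighbours"
  using assms
proof
  assume g: "row_map g (pow2_rel m) sum_label"
  have lab: "edge_less G {x, y} {x', y'} \<longleftrightarrow> sum_label (g x, g y) < sum_label (g x', g y')"
    if "nb x y" "nb x' y'" for x y x' y'
    using row_map_less_iff[OF g that] .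
  have pow: "\<exists>k. g y = g x + 2 ^ k" if "nb x y" for x y
    using g that unfolding row_map_def pow2_rel_def by auto
  have late_neighbours
    unfolding late_neighbours_def
  proof (intro allI impI)
    fix a a' b d assume nb: "nb a b" "nb a d" "nb a' b" and less: "edge_less G {a, b} {a, d}"
    obtain i j k where ij: "g b = g a + 2 ^ i" "g d = g a + 2 ^ j" "g b = g a' + 2 ^ k"
      using pow nb by metis
    have lt: "(2::nat) ^ i < 2 ^ j" using lab[OF nb(1,2)] less ij by (auto simp: sum_label_def less_prod_def)
    have "(2::nat) ^ Suc i \<le> 2 ^ j" using lt by (intro power_increasing) auto
    then have "2 * (2::nat) ^ i \<le> 2 ^ j" "(0::nat) < 2 ^ k" by simp_all
    then have "g a' + g b < g a + g d" using ij by linarith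
    then show "edge_less G {a', b} {a, d}" using lab[OF nb(3,2)] by (simp add: sum_label_def less_prod_def)
  qed
  then show ?thesis ..
next
  assume g: "row_map g ((pow2_rel m)\<inverse>) (sum_label \<circ> prod.swap)"
  have lab: "edge_less G {x, y} {x', y'} \<longleftrightarrow> sum_label (g y, g x) < sum_label (g y', g x')"
    if "nb x y" "nb x' y'" for x y x' y'
    using row_map_less_iff[OF g that] by simp
  have pow: "\<exists>k. g x = g y + 2 ^ k" if "nb x y" for x y
    using g that unfolding row_map_def pow2_rel_def by auto
  have early_neighbours
    unfolding early_neighbours_def
  proof (intro allI impI)
    fix a a' b d assume nb: "nb a b" "nb a d" "nb a' b" and less: "edge_less G {a, d} {a, b}"
    obtain i j k where ij: "g a = g b + 2 ^ i" "g a = g d + 2 ^ j" "g a' = g b + 2 ^ k"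
      using pow nb by metis
    have "g d < g b" using lab[OF nb(2,1)] less ij by (auto simp: sum_label_def less_prod_def)
    then have lt: "(2::nat) ^ i < 2 ^ j" using ij by linarith
    have "(2::nat) ^ Suc i \<le> 2 ^ j" using lt by (intro power_increasing) auto
    then have "2 * (2::nat) ^ i \<le> 2 ^ j" "(0::nat) < 2 ^ k" by simp_all
    then have "g d + g a < g b + g a'" using ij by linarith
    then show "edge_less G {a, d} {a', b}" using lab[OF nb(2,3)] by (simp add: sum_label_def less_prod_def)
  qed
  then show ?thesis ..
qed

end

section \<open>Rows that share a column\<close>

text \<open>A walk that turns back at a vertex can skip it: by \<open>mid\<close>, its two
  neighbours on the walk are related or equal. Removing all turns leaves a monotone chain.\<close>

lemma monotone_chains:
  fixes r :: "'a \<Rightarrow> 'b::linorder" and S :: "'a \<Rightarrow> 'a \<Rightarrow> bool"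
  defines "T \<equiv> {(x, y). S x y \<and> r x < r y}"
  assumes sym: "\<And>x y. S x y \<Longrightarrow> S y x"
    and inj: "\<And>x y. S x y \<Longrightarrow> r x = r y \<Longrightarrow> x = y"
    and mid: "\<And>x y z. S x y \<Longrightarrow> S y z \<Longrightarrow> \<not> S x z \<Longrightarrow> x \<noteq> z \<Longrightarrow> r x < r y \<longleftrightarrow> r y < r z"
    and xy: "(x, y) \<in> {(x, y). S x y}\<^sup>*"
  shows "(x, y) \<in> T\<^sup>* \<or> (y, x) \<in> T\<^sup>*"
proof -
  let ?R = "\<lambda>z. (x, z) \<in> T\<^sup>* \<or> (z, x) \<in> T\<^sup>*"
  have up: "S d e \<Longrightarrow> ?R e" if "(x, d) \<in> T\<^sup>*" for d e
    using that
  proof (induction arbitrary: e rule: rtrancl_induct)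
    case base
    then consider "(x, e) \<in> T" | "(e, x) \<in> T" | "x = e"
      using sym inj unfolding T_def by (cases rule: linorder_cases[of "r x" "r e"]) auto
    then show ?case by cases auto
  next
    case (step d' d)
    have S: "S d' d" "r d' < r d" using step.hyps(2) by (auto simp: T_def)
    have xd: "(x, d) \<in> T\<^sup>*" using step.hyps by simp
    show ?case
    proof (cases rule: linorder_cases[of "r d" "r e"])
      case less
      then have "(d, e) \<in> T" using step.prems by (simp add: T_def)
      then show ?thesis using xd by (meson rtrancl.rtrancl_into_rtrancl)
    next
      case equal
      then show ?thesis using xd inj[OF step.prems] by simp
    next
      case greater
      \<comment> \<open>The walk turns at \<open>d\<close>; \<open>e\<close> is reached from the
        earlier vertex \<open>d'\<close>, where the induction hypothesis applies.\<close>
      then have "S d' e \<or> d' = e" using mid[OF S(1) step.prems] S(2) not_less_iff_gr_or_eq by blast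
      then show ?thesis using step.IH step.hyps(1) by auto
    qed
  qed
  have down: "S d e \<Longrightarrow> ?R e" if "(d, x) \<in> T\<^sup>*" for d e
    using that
  proof (induction arbitrary: e rule: converse_rtrancl_induct)
    case base
    then show ?case using up[of x e] by simp
  next
    case (step d d')
    have S: "S d d'" "r d < r d'" using step.hyps(1) by (auto simp: T_def)
    have xd: "(d, x) \<in> T\<^sup>*" using step.hyps by simp
    show ?case
    proof (cases rule: linorder_cases[of "r d" "r e"])
      case greater
      then have "(e, d) \<in> T" using sym[OF step.prems] by (simp add: T_def)
      then show ?thesis using xd by (meson converse_rtrancl_into_rtrancl)
    next
      case equal
      then show ?thesis using xd inj[OF step.prems] by simp
    next
      case less
      then have "S d' e \<or> d' = e" using mid[OF sym[OF S(1)] step.prems] S(2) not_less_iff_gr_or_eq by blast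
      then show ?thesis using step.IH step.hyps(2) by auto
    qed
  qed
  show ?thesis
    using xy by (induction rule: rtrancl_induct) (use up down in auto)
qed

context row_split
begin

definition share :: "'a \<Rightarrow> 'a \<Rightarrow> bool" where
  "share a a' \<longleftrightarrow> (\<exists>b. nb a b \<and> nb a' b)"

definition no_extremes :: bool where
  "no_extremes \<longleftrightarrow> (\<forall>a v a' c a''. nb a v \<longrightarrow> nb a' v \<longrightarrow> nb a' c \<longrightarrow> nb a'' c \<longrightarrow> v \<noteq> c \<longrightarrow> a \<noteq> a'' \<longrightarrow>
     \<not> (rk a < rk a' \<and> rk a'' < rk a') \<and> \<not> (rk a' < rk a \<and> rk a' < rk a''))"

text \<open>The sign \<open>s\<close> treats a maximum and a minimum alike. Reading the path from
  either end lets the outer row farther in rank from \<open>a'\<close> come first.\<close>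

lemma no_extremesI:
  assumes hosts: "\<And>s t. s \<in> {1, -1} \<Longrightarrow> t \<in> {1, -1} \<Longrightarrow>
      \<exists>m g. row_map g (pow2_rel m) (lex_label s t) \<or>
        row_map g ((pow2_rel m)\<inverse>) (lex_label s t \<circ> prod.swap)"
  shows no_extremes
  unfolding no_extremes_def
proof (intro allI impI)
  fix a v a' c a''
  assume nb: "nb a v" "nb a' v" "nb a' c" "nb a'' c" and ne: "v \<noteq> c" "a \<noteq> a''"
  have False if s: "s \<in> {1, -1}" and "s * rk a < s * rk a'" "s * rk a'' < s * rk a'" for s
  proof -
    have "rk a \<noteq> rk a''" using rk_eq[OF nb(1,4)] ne by simp
    then have "s * rk a < s * rk a'' \<or> s * rk a'' < s * rk a" using s by auto
    then show False
      using no_extreme_row[OF hosts nb ne(1) s] no_extreme_row[OF hosts nb(4,3,2,1) _ s] that ne(1)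
      by metis
  qed
  from this[of 1] this[of "-1"]
  show "\<not> (rk a < rk a' \<and> rk a'' < rk a') \<and> \<not> (rk a' < rk a \<and> rk a' < rk a'')"
    by auto
qed

text \<open>Rows and columns alternate along a walk in \<open>G\<close>; at a column the induction
  remembers a row next to it that is already reached.\<close>

lemma share_connected:
  assumes conn: "connected_graph (underlying G)" and "nb a b" "nb a' b'"
  shows "(a, a') \<in> {(x, y). share x y}\<^sup>*"
proof -
  let ?S = "{(x, y). share x y}\<^sup>*"
  have "(a, a') \<in> (adjacency (underlying G))\<^sup>*"
    using conn assms nbD(1) A_verts unfolding connected_graph_def
    by (metis subset_iff verts_underlying)
  then have "(a' \<in> A \<longrightarrow> (a, a') \<in> ?S) \<and> (a' \<notin> A \<longrightarrow> (\<exists>d. nb d a' \<and> (a, d) \<in> ?S))"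
  proof (induction rule: rtrancl_induct)
    case base
    then show ?case using nbD(1)[OF assms(2)] by simp
  next
    case (step w z)
    then have wz: "{w, z} \<in> edges G" by (simp add: adjacency_def)
    show ?case
    proof (cases "w \<in> A")
      case True
      then have "nb w z" using wz by (simp add: nb_def)
      then show ?thesis using step.IH True nbD(2) by blast
    next
      case False
      then have zw: "nb z w" using edge_split[OF wz] wz by (auto simp: nb_def doubleton_eq_iff insert_commute)
      obtain d where "nb d w" "(a, d) \<in> ?S" using step.IH False by blast
      then have "(a, z) \<in> ?S" using zw by (auto simp: share_def intro: rtrancl_into_rtrancl)
      then show ?thesis using nbD(1)[OF zw] by simp
    qed
  qed
  then show ?thesis using nbD(1)[OF assms(3)] by simp
qed

text \<open>\<open>no_extremes\<close> is the turning condition of \<open>monotone_chains\<close>. A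
  monotone chain between consecutive rows has no room for a row in between, so it is a single
  step.\<close>

lemma consecutive_rows_share:
  assumes conn: "connected_graph (underlying G)" and ne: no_extremes
    and nb: "nb a b" "nb a' b'" and less: "rk a < rk a'"
    and cons: "\<And>d c. nb d c \<Longrightarrow> \<not> (rk a < rk d \<and> rk d < rk a')"
  shows "share a a'"
proof -
  define T where "T = {(x, y). share x y \<and> rk x < rk y}"
  have "(a, a') \<in> T\<^sup>* \<or> (a', a) \<in> T\<^sup>*"
    unfolding T_def
  proof (rule monotone_chains)
    show "share x y \<Longrightarrow> share y x" for x y by (auto simp: share_def)
    show inj: "share x y \<Longrightarrow> rk x = rk y \<Longrightarrow> x = y" for x y using rk_eq by (auto simp: share_def)
    show "rk x < rk y \<longleftrightarrow> rk y < rk z"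
      if xy: "share x y" and yz: "share y z" and nxz: "\<not> share x z" and "x \<noteq> z" for x y z
    proof -
      obtain v c where vc: "nb x v" "nb y v" "nb y c" "nb z c" using xy yz by (auto simp: share_def)
      then have "v \<noteq> c" using nxz by (auto simp: share_def)
      then have "\<not> (rk x < rk y \<and> rk z < rk y) \<and> \<not> (rk y < rk x \<and> rk y < rk z)"
        using ne vc \<open>x \<noteq> z\<close> unfolding no_extremes_def by blast
      moreover have "rk x \<noteq> rk y" "rk y \<noteq> rk z"
        using inj[OF xy] inj[OF yz] xy yz nxz by auto
      ultimately show ?thesis by linarith
    qed
    show "(a, a') \<in> {(x, y). share x y}\<^sup>*" by (rule share_connected[OF conn nb])
  qed
  moreover have mono: "rk x \<le> rk y" if "(x, y) \<in> T\<^sup>*" for x y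
    using that by (induction rule: rtrancl_induct) (auto simp: T_def)
  ultimately have "(a, a') \<in> T\<^sup>*" using less by fastforce
  then obtain d where d: "(a, d) \<in> T" "(d, a') \<in> T\<^sup>*"
    using less by (cases rule: converse_rtranclE) auto
  then obtain c where c: "nb d c" "share a d" "rk a < rk d" by (auto simp: T_def share_def)
  then have "rk d = rk a'" using mono[OF d(2)] cons[OF c(1)] by auto
  then show ?thesis using c rk_eq[OF c(1) nb(2)] by simp
qed

text \<open>If rows \<open>x\<close> and \<open>y\<close>, with \<open>x\<close> earlier, shared
  columns \<open>v\<close> and \<open>c\<close>, and \<open>xv\<close> came before
  \<open>xc\<close>, then \<open>yv\<close> would precede \<open>xc\<close>, against the order of
  the rows.\<close>

lemma late_neighbours_share_unique:
  assumes late: late_neighbours and nb: "nb a v" "nb a' v" "nb a c" "nb a' c" and "a \<noteq> a'"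
  shows "v = c"
proof -
  have False if *: "nb x v" "nb y v" "nb x c" "nb y c" "rk x < rk y" "edge_less G {x, v} {x, c}" for x y v c
  proof -
    have "edge_less G {y, v} {x, c}" using late * unfolding late_neighbours_def by blast
    then show False using nb_rk_le[OF *(2,3)] *(5) by linarith
  qed
  moreover have "rk a < rk a' \<or> rk a' < rk a" using rk_eq[OF nb(1,2)] \<open>a \<noteq> a'\<close> by linarith
  moreover have "edge_less G {x, v} {x, c} \<or> edge_less G {x, c} {x, v}" if "v \<noteq> c" "nb x v" "nb x c" for x
    using edge_less_linear[OF eog nbD(3)[OF that(2)] nbD(3)[OF that(3)]] nb_edge_eq[OF that(2,3)] that(1) by blast
  ultimately show ?thesis using nb by blast
qed

section \<open>Absence of cycles and the semi-caterpillar property\<close>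

text \<open>The row of largest rank on a cycle would be extreme between the two rows next to
  it.\<close>

lemma no_cycle:
  assumes ne: no_extremes
    and unique: "\<And>a a' v c. nb a v \<Longrightarrow> nb a' v \<Longrightarrow> nb a c \<Longrightarrow> nb a' c \<Longrightarrow> a \<noteq> a' \<Longrightarrow> v = c"
  shows "\<not> is_cycle (underlying G) vs"
proof
  assume cyc: "is_cycle (underlying G) vs"
  define n where "n = length vs"
  \<comment> \<open>Reading the cycle modulo its length removes the special treatment of the closing
    edge.\<close>
  define w where "w i = vs ! (i mod n)" for i
  have n: "n \<ge> 3" using cyc by (simp add: is_cycle_def n_def)
  have w_eq: "w i = w j \<longleftrightarrow> i mod n = j mod n" for i j
  proof -
    have "i mod n < length vs" "j mod n < length vs" using n by (auto simp flip: n_def)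
    then show ?thesis using cyc by (simp add: w_def is_cycle_def nth_eq_iff_index_eq)
  qed
  have edge: "{w i, w (Suc i)} \<in> edges G" for i
  proof (cases "Suc (i mod n) = n")
    case True
    then have "i mod n = n - 1" by simp
    then have "w (Suc i) = vs ! 0" "w i = vs ! (n - 1)" using True by (simp_all add: w_def mod_Suc)
    moreover have "hd vs = vs ! 0" "last vs = vs ! (n - 1)"
      using n hd_conv_nth[of vs] last_conv_nth[of vs] by (cases "vs = []"; simp add: n_def)+
    ultimately show ?thesis using cyc by (auto simp: is_cycle_def)
  next
    case False
    then have "Suc (i mod n) < n" using n by (metis Suc_lessI mod_less_divisor not_less0 not_gr_zero not_numeral_le_zero)
    then show ?thesis using cyc False by (auto simp: is_cycle_def w_def mod_Suc n_def)
  qed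
  define I where "I = {i. i < n \<and> w i \<in> A}"
  have "w 0 \<in> A \<or> w 1 \<in> A" using edge_split[OF edge[of 0]] by (auto simp: doubleton_eq_iff)
  then have "I \<noteq> {}" using n by (auto simp: I_def intro: exI[of _ "0::nat"] exI[of _ "1::nat"])
  moreover have "finite I" by (simp add: I_def)
  ultimately obtain i where i: "i \<in> I" "\<And>j. j \<in> I \<Longrightarrow> rk (w j) \<le> rk (w i)"
    using Max_in[of "(\<lambda>j. rk (w j)) ` I"] Max_ge[of "(\<lambda>j. rk (w j)) ` I"] by fastforce
  have mx: "rk (w j) \<le> rk (w i)" if "w j \<in> A" for j
  proof -
    have "w (j mod n) = w j" by (simp add: w_def)
    then show ?thesis using i(2)[of "j mod n"] that n by (auto simp: I_def)
  qed
  \<comment> \<open>The path runs from position \<open>k\<close> to \<open>k + 4\<close> with the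
    maximal row in the middle; adding \<open>n\<close> keeps the subtraction exact.\<close>
  define k where "k = i + n - 2"
  have "k + 2 = i + n" using n by (simp add: k_def)
  then have k: "w (k + 2) = w i" by (simp add: w_def)
  have a': "w (k + 2) \<in> A" using i(1) k by (simp add: I_def)
  have nb1: "nb (w (k + 2)) (w (k + 1))"
    using a' edge[of "k + 1"] by (simp add: nb_def insert_commute)
  have nb2: "nb (w (k + 2)) (w (k + 3))"
    using a' edge[of "k + 2"] by (simp add: nb_def eval_nat_numeral)
  have nb0: "nb (w k) (w (k + 1))"
    using edge[of k] edge_split[OF edge[of k]] nbD(2)[OF nb1] by (auto simp: nb_def doubleton_eq_iff)
  have nb4: "nb (w (k + 4)) (w (k + 3))"
    using edge[of "k + 3"] edge_split[OF edge[of "k + 3"]] nbD(2)[OF nb2]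
    by (auto simp: nb_def doubleton_eq_iff eval_nat_numeral insert_commute)
  have mod_ne: "(k + x) mod n \<noteq> (k + x + 2) mod n" for x
  proof
    assume "(k + x) mod n = (k + x + 2) mod n"
    then have "n dvd 2" by (metis add_diff_cancel_left' le_add1 mod_eq_dvd_iff_nat)
    then show False using n dvd_imp_le[of n 2] by simp
  qed
  have "w (k + 1) \<noteq> w (k + 3)" using mod_ne[of 1] by (simp add: w_eq eval_nat_numeral)
  moreover have "w k \<noteq> w (k + 2)" using mod_ne[of 0] by (simp add: w_eq eval_nat_numeral)
  moreover have "w (k + 4) \<noteq> w (k + 2)" using mod_ne[of 2] by (simp add: w_eq eval_nat_numeral)
  \<comment> \<open>Equality would be a 4-cycle, in which two rows share two columns.\<close>
  moreover have "w k \<noteq> w (k + 4)"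
    using unique[OF nb0 nb1 _ nb2] nb4 calculation by metis
  moreover have "rk (w k) < rk (w (k + 2))" "rk (w (k + 4)) < rk (w (k + 2))"
    using mx[of k] mx[of "k + 4"] k nbD(1)[OF nb0] nbD(1)[OF nb4] rk_eq[OF nb0 nb1] rk_eq[OF nb4 nb1] calculation
    by auto
  ultimately show False
    using ne nb0 nb1 nb2 nb4 unfolding no_extremes_def by blast
qed

text \<open>Consecutive edges \<open>ab\<close> and \<open>a'b'\<close> in different rows lie in
  consecutive rows, which share a column. Any shared column other than \<open>b\<close> contradicts
  \<open>late_neighbours\<close> or gives an edge between the two. So \<open>a'b\<close> is an edge;
  it comes after \<open>ab\<close>, and not between them, so it equals or exceeds
  \<open>a'b'\<close>.\<close>

lemma late_neighbours_semi_caterpillar: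
  assumes conn: "connected_graph (underlying G)" and "edges G \<noteq> {}"
    and ne: no_extremes and late: late_neighbours
  shows "semi_caterpillar G"
proof -
  have "simple_graph (underlying G)"
    using eog by (simp add: edge_ordered_graph_def simple_graph_def)
  then have "is_tree (underlying G)"
    using conn no_cycle[OF ne late_neighbours_share_unique[OF late]] by (auto simp: is_tree_def)
  moreover have "e1 \<inter> e2 \<noteq> {} \<or> (\<exists>u \<in> e1. \<exists>v \<in> e2.
      {u, v} \<in> edges G \<and> edge_less G e1 {u, v} \<and> edge_less G e2 {u, v})"
    if cons: "consecutive_edges G e1 e2" for e1 e2
  proof -
    have less: "edge_less G e1 e2" and between: "\<And>e. edge_less G e1 e \<Longrightarrow> edge_less G e e2 \<Longrightarrow> False"
      using cons edge_less_edges[OF eog] unfolding consecutive_edges_def by blast+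
    have "e1 \<in> edges G" "e2 \<in> edges G" using cons by (auto simp: consecutive_edges_def)
    then obtain a b a' b' where e: "nb a b" "e1 = {a, b}" "nb a' b'" "e2 = {a', b'}"
      using edge_nb by metis
    show ?thesis
    proof (cases "a = a' \<or> b = b'")
      case True
      then show ?thesis using e by auto
    next
      case False
      then have rk: "rk a < rk a'"
        using nb_rk_le[OF e(1,3)] less e rk_eq[OF e(1,3)] by auto
      have "\<not> (rk a < rk d \<and> rk d < rk a')" if "nb d c" for d c
        using between[of "{d, c}"] nb_less[OF e(1) that] nb_less[OF that e(3)] e by auto
      then obtain s where s: "nb a s" "nb a' s"
        using consecutive_rows_share[OF conn ne e(1,3) rk] unfolding share_def by blast
      have "s = b"
      proof (rule ccontr)
        assume "s \<noteq> b"
        then consider "edge_less G {a, s} {a, b}" | "edge_less G {a, b} {a, s}"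
          using edge_less_linear[OF eog nbD(3)[OF s(1)] nbD(3)[OF e(1)]] nb_edge_eq[OF s(1) e(1)] by blast
        then show False
        proof cases
          case 1
          then have "edge_less G {a', s} {a, b}" using late s e unfolding late_neighbours_def by blast
          then show False using nb_rk_le[OF s(2) e(1)] rk by linarith
        next
          case 2
          then show False using between nb_less[OF s(1) e(3) rk] e by auto
        qed
      qed
      then have "edge_less G e1 {b, a'}" "{b, a'} \<in> edges G"
        using nb_less[OF e(1) s(2) rk] nbD(3)[OF s(2)] e by (auto simp: insert_commute)
      moreover have "{b, a'} \<noteq> e2" using False e nb_edge_eq[OF s(2) e(3)] \<open>s = b\<close> by (simp add: insert_commute)
      ultimately have "edge_less G e1 {b, a'} \<and> edge_less G e2 {b, a'} \<and> {b, a'} \<in> edges G"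
        using between edge_less_linear[OF eog, of "{b, a'}" e2] \<open>e2 \<in> edges G\<close> by blast
      then show ?thesis using e by blast
    qed
  qed
  ultimately show ?thesis
    using eog \<open>edges G \<noteq> {}\<close> by (auto simp: semi_caterpillar_def)
qed

end

context row_split
begin

lemma late_neighbours_reverse:
  assumes early_neighbours
  shows "row_split.late_neighbours (reverse_eo G) A"
  using assms unfolding early_neighbours_def
    row_split.late_neighbours_def[OF row_split_reverse[OF row_split_axioms]]
    row_split_nb_reverse[OF row_split_axioms] by simp

lemma no_extremes_reverse:
  assumes no_extremes
  shows "row_split.no_extremes (reverse_eo G) A (\<lambda>v. - rk v)"
  using assms unfolding no_extremes_def
    row_split.no_extremes_def[OF row_split_reverse[OF row_split_axioms]]
    row_split_nb_reverse[OF row_split_axioms] by simp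

text \<open>If the bound failed, \<open>G\<close> would occur in the host under each of its five
  labels: the four lexicographic ones give \<open>no_extremes\<close>, and the label
  \<open>x + y\<close> makes \<open>G\<close> or its reverse a semi-caterpillar.\<close>

lemma card_pow2_rel_le_ex_eo:
  assumes conn: "connected_graph (underlying G)" and ed: "edges G \<noteq> {}"
    and not_semi: "\<not> semi_caterpillar G" "\<not> semi_caterpillar (reverse_eo G)"
  shows "card (pow2_rel (n div 2)) \<le> ex_eo n G"
proof (rule ccontr)
  define R where "R = pow2_rel (n div 2)"
  assume "\<not> ?thesis"
  then have small: "ex_eo n G < card R" by (simp add: R_def)
  \<comment> \<open>The label type is left open, since both pairs of integers and pairs of naturals
    are used.\<close>
  have emb: "\<exists>g. row_map g R l \<or> row_map g (R\<inverse>) (l \<circ> prod.swap)"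
    if inj: "inj_on l R" for l :: "nat \<times> nat \<Rightarrow> 'b::linorder"
  proof -
    have sub: "R \<subseteq> {..<n div 2} \<times> {..<n div 2}" using pow2_rel_subset by (simp add: R_def)
    have "eo_contains (bip_host n R l) G"
    proof (rule ccontr)
      assume "\<not> ?thesis"
      then have "card (edges (bip_host n R l)) \<le> ex_eo n G"
        by (intro ex_eo_ge edge_ordered_bip_host inj sub) simp_all
      then show False using small by (simp only: card_bip_host)
    qed
    then show ?thesis by (rule bip_host_row_map[OF conn inj sub])
  qed
  have ne: no_extremes
  proof (rule no_extremesI)
    fix s t :: int assume "s \<in> {1, -1}" "t \<in> {1, -1}"
    then have "inj_on (lex_label s t) R" by (intro inj_lex_label) auto
    then show "\<exists>m g. row_map g (pow2_rel m) (lex_label s t) \<or>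
        row_map g ((pow2_rel m)\<inverse>) (lex_label s t \<circ> prod.swap)"
      using emb R_def by blast
  qed
  have "late_neighbours \<or> early_neighbours"
    using emb[OF inj_sum_label] sum_host_neighbours unfolding R_def by blast
  then show False
  proof
    assume late_neighbours
    then show False using late_neighbours_semi_caterpillar[OF conn ed ne] not_semi by blast
  next
    assume early_neighbours
    then have "semi_caterpillar (reverse_eo G)"
      using row_split.late_neighbours_semi_caterpillar[OF row_split_reverse[OF row_split_axioms]]
        late_neighbours_reverse no_extremes_reverse[OF ne] conn ed by simp
    then show False using not_semi by blast
  qed
qed

end

section \<open>The lower bound of order n log n\<close>

text \<open>Take \<open>K\<close> with \<open>2 ^ K\<close> at most \<open>m\<close> and
  \<open>m < 2 ^ Suc K\<close>, where \<open>m = n div 2\<close>. Then \<open>K\<close> is at least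
  \<open>ln n / 4\<close> and \<open>m - m div 2\<close> is at least \<open>n / 8\<close>, whence
  the constant 32.\<close>

lemma card_pow2_rel_ge:
  assumes n: "n \<ge> 16"
  shows "real n * ln (real n) / 32 \<le> real (card (pow2_rel (n div 2)))"
proof -
  define m where "m = n div 2"
  have m: "m \<ge> 8" "real m \<ge> real n / 4" using n unfolding m_def by linarith+
  obtain K where K: "2 ^ K \<le> m" "m < 2 ^ Suc K"
    using ex_power_ivl1[of 2 m] m by auto
  have "K \<noteq> 0" using K m by (intro notI) simp
  have "ln (real m) \<le> real (Suc K) * ln 2"
  proof -
    have "real m \<le> 2 ^ Suc K" using K(2) by (metis less_imp_le numeral_power_eq_of_nat_cancel_iff of_nat_le_iff)
    then have "ln (real m) \<le> ln (2 ^ Suc K)" using m by (subst ln_le_cancel_iff) auto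
    then show ?thesis by (simp only: ln_realpow zero_less_numeral)
  qed
  also have "\<dots> \<le> real (Suc K) * 1"
    using ln_2_less_1 by (intro mult_left_mono) auto
  finally have lnm: "ln (real m) \<le> 2 * real K" using \<open>K \<noteq> 0\<close> by simp
  have "ln (real n) \<le> 2 * ln (real m)"
  proof -
    have "real n \<le> 4 * real m" using m by simp
    also have "\<dots> \<le> real m * real m" using m by (intro mult_right_mono) auto
    finally have "ln (real n) \<le> ln (real m * real m)" using n m by (subst ln_le_cancel_iff) auto
    then show ?thesis using m by (simp add: ln_mult)
  qed
  then have "ln (real n) / 4 \<le> real K" using lnm by simp
  moreover have "real n / 8 \<le> real (m - m div 2)" using m by linarith
  moreover have "0 \<le> ln (real n)" using n by simp
  ultimately have "(ln (real n) / 4) * (real n / 8) \<le> real K * real (m - m div 2)"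
    by (intro mult_mono) auto
  also have "\<dots> \<le> real (card (pow2_rel m))"
    using card_pow2_rel[OF K(1)] by (metis of_nat_le_iff of_nat_mult)
  finally show ?thesis by (simp add: m_def field_simps)
qed

lemma bigomega_nlogn:
  fixes f :: "nat \<Rightarrow> nat"
  assumes "\<And>n. n \<ge> 16 \<Longrightarrow> real n * ln (real n) / 32 \<le> real (f n)"
  shows "(\<lambda>n. real (f n)) \<in> \<Omega>(\<lambda>n. real n * ln (real n))"
proof (rule landau_omega.bigI[of "1 / 32"])
  show "\<forall>\<^sub>F n in sequentially. (1 / 32) * norm (real n * ln (real n)) \<le> norm (real (f n))"
    using eventually_ge_at_top[of 16]
  proof eventually_elim
    case (elim n)
    then have "0 \<le> real n * ln (real n)" by simp
    then show ?case using assms[OF elim] by simp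
  qed
qed simp

lemma quadratic_ge:
  assumes n: "n \<ge> 16"
  shows "real n * ln (real n) / 32 \<le> real ((n div 2) * (n - n div 2))"
proof -
  have "ln (real n) \<le> real n" using n ln_le_minus_one[of "real n"] by linarith
  then have "real n * ln (real n) / 32 \<le> real n * real n / 32"
    by (intro divide_right_mono mult_left_mono) auto
  also have "\<dots> \<le> (real n / 4) * (real n / 4)" by simp
  also have "\<dots> \<le> real (n div 2) * real (n - n div 2)"
    using n by (intro mult_mono) linarith+
  finally show ?thesis by simp
qed

text \<open>A failing chromatic condition, for \<open>G\<close> or for its reverse, gives a
  quadratic bound. Otherwise neither of the two is a semi-caterpillar, and the power-of-two host
  applies.\<close>

lemma ex_eo_lower:
  assumes G: "edge_ordered_graph G" and conn: "connected_graph (underlying G)" and ed: "edges G \<noteq> {}"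
    and neg: "\<not> ((semi_caterpillar G \<and> order_chromatic_number G = 2) \<or>
             (semi_caterpillar (reverse_eo G) \<and> order_chromatic_number (reverse_eo G) = 2))"
  shows "(\<lambda>n. real (ex_eo n G)) \<in> \<Omega>(\<lambda>n. real n * ln (real n))"
proof (rule bigomega_nlogn)
  fix n :: nat assume n: "n \<ge> 16"
  consider "order_chromatic_number G \<noteq> 2" | "order_chromatic_number (reverse_eo G) \<noteq> 2"
    | "order_chromatic_number G = 2" "\<not> semi_caterpillar G" "\<not> semi_caterpillar (reverse_eo G)"
    using neg by blast
  then show "real n * ln (real n) / 32 \<le> real (ex_eo n G)"
  proof cases
    case 1
    then have "(n div 2) * (n - n div 2) \<le> ex_eo n G" using ex_eo_quadratic[OF G ed] n by simp
    then show ?thesis using quadratic_ge[OF n] by (meson of_nat_le_iff order_trans)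
  next
    case 2
    then have "(n div 2) * (n - n div 2) \<le> ex_eo n (reverse_eo G)"
      using ex_eo_quadratic[of "reverse_eo G" n] G ed n by simp
    then show ?thesis using quadratic_ge[OF n] ex_eo_reverse[OF G] by (metis of_nat_le_iff order_trans)
  next
    case 3
    then obtain A rk where "row_split G A rk" using order_chromatic_number_2_row_split[OF G] by blast
    then have "card (pow2_rel (n div 2)) \<le> ex_eo n G"
      using row_split.card_pow2_rel_le_ex_eo conn ed 3 by blast
    then show ?thesis using card_pow2_rel_ge[OF n] by (meson of_nat_le_iff order_trans)
  qed
qed

section \<open>Patterns grown row by row\<close>

text \<open>The edges are listed in increasing order; \<open>a\<close> is the last row and \<open>b\<close> its last column. In the
  edgeless starting pattern \<open>a\<close> is a dummy outside \<open>V\<close>.\<close>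

inductive row_pattern :: "('a \<times> 'a) list \<Rightarrow> 'a set \<Rightarrow> 'a \<Rightarrow> 'a \<Rightarrow> bool" where
  start: "a \<noteq> b \<Longrightarrow> row_pattern [] {b} a b"
| row: "row_pattern es V a b \<Longrightarrow> distinct (a' # P @ Q) \<Longrightarrow> set (a' # P @ Q) \<inter> V = {} \<Longrightarrow>
    row_pattern (es @ map (Pair a') (P @ b # Q)) (V \<union> set (a' # P @ Q)) a' (last (b # Q))"

lemma row_patternD:
  assumes "row_pattern es V a b"
  shows "finite V" "b \<in> V" "es \<noteq> [] \<Longrightarrow> last es = (a, b)" "fst ` set es \<union> snd ` set es \<subseteq> V"
  using assms by (induction rule: row_pattern.induct) (auto simp: last_map)

definition emb :: "('v \<times> 'v) set \<Rightarrow> ('v \<Rightarrow> 'v \<Rightarrow> int) \<Rightarrow> ('a \<Rightarrow> 'v) \<Rightarrow> 'a set \<Rightarrow> ('a \<times> 'a) list \<Rightarrow> bool" where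
  "emb D l \<phi> V es \<longleftrightarrow> inj_on \<phi> V \<and> (\<forall>(a, b) \<in> set es. (\<phi> a, \<phi> b) \<in> D) \<and>
     sorted_wrt (<) (map (\<lambda>(a, b). l (\<phi> a) (\<phi> b)) es)"

definition good :: "('v \<times> 'v) set \<Rightarrow> ('v \<Rightarrow> 'v \<Rightarrow> int) \<Rightarrow> ('a \<times> 'a) list \<Rightarrow> 'a set \<Rightarrow> 'a \<Rightarrow> 'a \<Rightarrow> 'v \<Rightarrow> 'v \<Rightarrow> bool" where
  "good D l es V a b x y \<longleftrightarrow> (\<exists>\<phi>. emb D l \<phi> V es \<and> \<phi> a = x \<and> \<phi> b = y)"

text \<open>Each edge occurs in \<open>D\<close> in both orientations, so that its row end can be
  told from its column end; the label \<open>l\<close> depends on the unordered edge only.\<close>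

locale edge_host =
  fixes W :: "'v set" and D :: "('v \<times> 'v) set" and l :: "'v \<Rightarrow> 'v \<Rightarrow> int"
  assumes finite_W: "finite W" and D_sub: "D \<subseteq> W \<times> W"
    and D_sym: "(x, y) \<in> D \<Longrightarrow> (y, x) \<in> D" and D_irrefl: "(x, x) \<notin> D"
    and l_sym: "l x y = l y x"
    and l_inj: "(x, y) \<in> D \<Longrightarrow> (x', y') \<in> D \<Longrightarrow> l x y = l x' y' \<Longrightarrow> {x, y} = {x', y'}"

text \<open>The dummy \<open>a\<close> lies outside \<open>{b}\<close>, so its image is
  unconstrained.\<close>

lemma good_start: "a \<noteq> b \<Longrightarrow> good D l [] {b} a b x y"
  unfolding good_def emb_def by (rule exI[of _ "(\<lambda>_. x)(b := y)"]) auto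

lemma extend_map:
  assumes "length ws = length zs" and "distinct ws"
  shows "\<exists>\<psi>. (\<forall>v. v \<notin> set ws \<longrightarrow> \<psi> v = \<phi> v) \<and> map \<psi> ws = zs"
  using assms
proof (induction ws zs rule: list_induct2)
  case (Cons w ws z zs)
  then obtain \<psi> where \<psi>: "\<forall>v. v \<notin> set ws \<longrightarrow> \<psi> v = \<phi> v" "map \<psi> ws = zs" by auto
  have "map (\<psi>(w := z)) (w # ws) = z # zs" using \<psi>(2) Cons.prems by (auto intro!: map_cong)
  then show ?case using \<psi>(1) by (intro exI[of _ "\<psi>(w := z)"]) auto
qed auto

lemma sorted_wrt_less_le_last:
  fixes xs :: "'b::linorder list"
  assumes "sorted_wrt (<) xs" and "u \<in> set xs"
  shows "u \<le> last xs"
  using assms by (cases xs rule: rev_cases) (auto simp: sorted_wrt_append less_imp_le)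

lemma ex_sorted_list:
  fixes f :: "'b \<Rightarrow> int"
  assumes "finite S" "k \<le> card S" "inj_on f S"
  shows "\<exists>zs. length zs = k \<and> set zs \<subseteq> S \<and> sorted_wrt (<) (map f zs)"
proof -
  obtain T where T: "T \<subseteq> S" "card T = k" using assms(1,2) by (meson obtain_subset_with_card_n)
  then have fin: "finite T" and inj: "inj_on f T" using assms finite_subset inj_on_subset by blast+
  define zs where "zs = map (inv_into T f) (sorted_list_of_set (f ` T))"
  have "f (inv_into T f y) = y" if "y \<in> f ` T" for y using that by (rule f_inv_into_f)
  then have "map f zs = sorted_list_of_set (f ` T)"
    unfolding zs_def map_map by (intro map_idI) (use fin in auto)
  moreover have "set zs \<subseteq> T" using fin by (auto simp: zs_def inv_into_into)
  ultimately show ?thesis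
    using T card_image[OF inj] by (intro exI[of _ zs]) (auto simp: zs_def)
qed

text \<open>The rank of an element within \<open>S\<close> is injective, so the ranks below
  \<open>K\<close> are taken at most \<open>K\<close> times.\<close>

lemma card_few_below:
  fixes f :: "'b \<Rightarrow> int"
  assumes fin: "finite S" and inj: "inj_on f S"
  shows "card {s \<in> S. card {t \<in> S. f t < f s} < K} \<le> K"
proof -
  define r where "r s = card {t \<in> S. f t < f s}" for s
  have less: "r s < r s'" if "s \<in> S" "s' \<in> S" "f s < f s'" for s s'
    unfolding r_def by (rule psubset_card_mono) (use fin that in auto)
  have "inj_on r S"
  proof (rule inj_onI)
    fix s s' assume "s \<in> S" "s' \<in> S" "r s = r s'"
    then show "s = s'" using less[of s s'] less[of s' s] inj
      by (metis inj_onD less_irrefl linorder_neqE)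
  qed
  then have "card {s \<in> S. r s < K} = card (r ` {s \<in> S. r s < K})"
    by (metis (no_types, lifting) card_image inj_on_subset mem_Collect_eq subsetI)
  also have "\<dots> \<le> card {..<K}" by (rule card_mono) auto
  finally show ?thesis by (simp add: r_def)
qed

text \<open>The height \<open>h\<close> is a parameter because negated labels turn the lowest edges
  at \<open>x\<close> into the highest ones.\<close>

definition low_rank :: "('v \<Rightarrow> 'v \<Rightarrow> int) \<Rightarrow> ('v \<times> 'v) set \<Rightarrow> nat \<Rightarrow> ('v \<times> 'v) set" where
  "low_rank h F K = {(x, y) \<in> F. card {z. (x, z) \<in> F \<and> h x z < h x y} < K}"

lemma card_low_rank:
  assumes fin: "finite W" and sub: "F \<subseteq> W \<times> W" and inj: "\<And>x. inj_on (h x) {y. (x, y) \<in> F}"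
  shows "card (low_rank h F K) \<le> K * card W"
proof -
  define B where "B x = {y \<in> {y. (x, y) \<in> F}. card {z \<in> {y. (x, y) \<in> F}. h x z < h x y} < K}" for x
  have finF: "finite {y. (x, y) \<in> F}" for x
    by (rule finite_subset[OF _ fin]) (use sub in auto)
  then have "finite (B x)" for x by (simp add: B_def)
  moreover have "low_rank h F K = (SIGMA x:W. B x)" using sub by (auto simp: low_rank_def B_def)
  ultimately have "card (low_rank h F K) = (\<Sum>x\<in>W. card (B x))" using fin by simp
  also have "\<dots> \<le> (\<Sum>x\<in>W. K)"
    unfolding B_def by (intro sum_mono card_few_below finF inj)
  finally show ?thesis by (simp add: mult.commute)
qed

section \<open>Extending a copy by one row\<close>

context edge_host
begin

lemma l_inj_row:
  assumes "F \<subseteq> D"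
  shows "inj_on (l x) {y. (x, y) \<in> F}"
proof (rule inj_onI)
  fix y z assume "y \<in> {y. (x, y) \<in> F}" "z \<in> {y. (x, y) \<in> F}" "l x y = l x z"
  then have "{x, y} = {x, z}" using l_inj assms by blast
  then show "y = z" by (auto simp: doubleton_eq_iff)
qed

lemma finite_D: "finite D"
  by (rule finite_subset[OF D_sub]) (simp add: finite_W)

text \<open>The vertices \<open>a'\<close>, \<open>P\<close>, \<open>Q\<close> are sent to the fresh
  vertices \<open>x\<close>, \<open>zP\<close>, \<open>zQ\<close>. The last old edge has label
  \<open>l (\<phi> a) y\<close>, so \<open>above\<close> places the whole new row after the old
  copy.\<close>

lemma emb_extend:
  assumes pat: "row_pattern es V a b" and emb: "emb D l \<phi> V es" and y: "\<phi> b = y"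
    and new: "distinct (a' # P @ Q)" "set (a' # P @ Q) \<inter> V = {}"
    and x: "(x, y) \<in> D" "x \<notin> \<phi> ` V"
    and len: "length zP = length P" "length zQ = length Q"
    and zs: "\<And>z. z \<in> set (zP @ zQ) \<Longrightarrow> (x, z) \<in> D \<and> z \<notin> \<phi> ` V"
    and sorted: "sorted_wrt (<) (map (l x) (zP @ y # zQ))"
    and above: "\<And>z. z \<in> set (zP @ [y]) \<Longrightarrow> l (\<phi> a) y < l x z"
  shows "good D l (es @ map (Pair a') (P @ b # Q)) (V \<union> set (a' # P @ Q)) a' (last (b # Q))
    x (last (y # zQ))"
proof -
  have bV: "b \<in> V" and esV: "fst ` set es \<union> snd ` set es \<subseteq> V" using row_patternD[OF pat] by auto
  obtain \<psi> where \<psi>: "\<And>v. v \<notin> set (a' # P @ Q) \<Longrightarrow> \<psi> v = \<phi> v" and map: "map \<psi> (a' # P @ Q) = x # zP @ zQ"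
    using extend_map[of "a' # P @ Q" "x # zP @ zQ" \<phi>] len new(1) by auto
  have mapP: "map \<psi> P = zP" and mapQ: "map \<psi> Q = zQ" and \<psi>a': "\<psi> a' = x"
    using map len by (auto simp: append_eq_append_conv)
  have \<psi>V: "\<psi> v = \<phi> v" if "v \<in> V" for v using \<psi> new(2) that by blast
  have \<psi>b: "\<psi> b = y" using \<psi>V[OF bV] y by simp
  have "distinct (map (l x) (zP @ y # zQ))"
    using sorted by (simp add: strict_sorted_iff flip: sorted_wrt_map)
  then have "distinct (x # zP @ zQ)" using zs D_irrefl by (auto simp: distinct_map)
  then have "distinct (map \<psi> (a' # P @ Q))" using map by simp
  then have "inj_on \<psi> (set (a' # P @ Q))" unfolding distinct_map by blast
  moreover have "\<psi> ` set (a' # P @ Q) = set (x # zP @ zQ)" using map by (metis set_map)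
  then have "\<psi> ` set (a' # P @ Q) \<inter> \<phi> ` V = {}" using x(2) zs by auto
  moreover have "inj_on \<psi> V" using emb \<psi>V unfolding emb_def by (metis (no_types, lifting) inj_on_cong)
  moreover have "\<psi> ` V = \<phi> ` V" using \<psi>V by (intro image_cong) auto
  ultimately have inj: "inj_on \<psi> (V \<union> set (a' # P @ Q))"
    unfolding inj_on_Un by blast
  let ?lab = "\<lambda>(a, b). l (\<psi> a) (\<psi> b)"
  have es_lab: "map ?lab es = map (\<lambda>(a, b). l (\<phi> a) (\<phi> b)) es"
    using esV \<psi>V by (intro map_cong) force+
  have row_lab: "map ?lab (map (Pair a') (P @ b # Q)) = map (l x) (zP @ y # zQ)"
    using mapP mapQ \<psi>a' \<psi>b by (auto simp: o_def map_eq_conv)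
  have es_sorted: "sorted_wrt (<) (map ?lab es)" using emb unfolding es_lab emb_def by blast
  \<comment> \<open>Old labels are at most the last one, and labels of \<open>zQ\<close> exceed that
    of \<open>y\<close>; comparing the last old label with \<open>zP\<close> and \<open>y\<close>
    therefore suffices.\<close>
  have cross: "u < v" if u: "u \<in> set (map ?lab es)" and v: "v \<in> set (map (l x) (zP @ y # zQ))" for u v
  proof -
    have ne: "es \<noteq> []" using u by auto
    have "last (map ?lab es) = l (\<phi> a) y"
      using row_patternD(3)[OF pat ne] ne y unfolding es_lab by (simp add: last_map)
    moreover have "u \<le> last (map ?lab es)"
      by (rule sorted_wrt_less_le_last[OF es_sorted u])
    moreover have "l (\<phi> a) y < v"
    proof (cases "v \<in> set (map (l x) (zP @ [y]))")
      case True
      then show ?thesis using above by auto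
    next
      case False
      then have "v \<in> set (map (l x) zQ)" using v by auto
      then have "l x y < v" using sorted by (auto simp: sorted_wrt_append)
      then show ?thesis using above[of y] by simp
    qed
    ultimately show ?thesis by linarith
  qed
  have "sorted_wrt (<) (map ?lab (es @ map (Pair a') (P @ b # Q)))"
    unfolding map_append[of _ es] sorted_wrt_append row_lab
    using es_sorted sorted cross by blast
  moreover have "(\<psi> c, \<psi> d) \<in> D" if "(c, d) \<in> set (es @ map (Pair a') (P @ b # Q))" for c d
  proof (cases "(c, d) \<in> set es")
    case True
    then have "c \<in> V" "d \<in> V" "(\<phi> c, \<phi> d) \<in> D" using esV emb by (force simp: emb_def)+
    then show ?thesis using \<psi>V by simp
  next
    case False
    then have "c = a'" "d \<in> set (P @ b # Q)" using that by auto
    moreover have "set (map \<psi> (P @ b # Q)) = set (zP @ y # zQ)" using mapP mapQ \<psi>b by simp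
    ultimately have "\<psi> c = x" "\<psi> d \<in> set (zP @ y # zQ)" using \<psi>a' by (metis, metis image_eqI set_map)
    then show ?thesis using zs x(1) by auto
  qed
  ultimately have "emb D l \<psi> (V \<union> set (a' # P @ Q)) (es @ map (Pair a') (P @ b # Q))"
    using inj unfolding emb_def by auto
  moreover have "\<psi> (last (b # Q)) = last (y # zQ)"
    using mapQ \<psi>b by (metis last_map list.discI list.simps(9))
  ultimately show ?thesis using \<psi>a' unfolding good_def by blast
qed

text \<open>The least label of \<open>F\<close> at \<open>y\<close> belongs to an edge that already ends a copy of the smaller
  pattern; any later edge at \<open>y\<close> whose row has many edges in between would extend that copy.\<close>

lemma row_step_exceptions:
  assumes pat: "row_pattern es V a b"
    and new: "distinct (a' # P @ Q)" "set (a' # P @ Q) \<inter> V = {}"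
    and F: "F \<subseteq> D" and g0: "\<And>x y. (x, y) \<in> F \<Longrightarrow> good D l es V a b x y"
    and g1: "\<And>x y. (x, y) \<in> F \<Longrightarrow>
      \<not> good D l (es @ map (Pair a') (P @ b # Q)) (V \<union> set (a' # P @ Q)) a' (last (b # Q)) x y"
    and m: "\<And>y. m y = Min {l x y | x. (x, y) \<in> F}"
    and K: "K = Suc (card V + length P + length Q)"
  shows "\<exists>E \<subseteq> F. card E \<le> 2 * K * card W \<and>
    (\<forall>(x, y) \<in> F - E. card {z. (x, z) \<in> F \<and> m y < l x z \<and> l x z < l x y} < K)"
proof -
  have finF: "finite F" using F finite_D finite_subset by blast
  have "\<forall>y \<in> snd ` F. \<exists>\<phi>. (\<phi> a, y) \<in> F \<and> l (\<phi> a) y = m y \<and> emb D l \<phi> V es \<and> \<phi> b = y"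
  proof
    fix y assume "y \<in> snd ` F"
    then obtain x where xy: "(x, y) \<in> F" by auto
    let ?S = "{l x y | x. (x, y) \<in> F}"
    have "?S \<subseteq> (\<lambda>(x, y). l x y) ` F" by force
    then have "finite ?S" using finF finite_surj by blast
    then have "m y \<in> ?S" unfolding m by (rule Min_in) (use xy in blast)
    then obtain x0 where x0: "(x0, y) \<in> F" "l x0 y = m y" by auto
    then show "\<exists>\<phi>. (\<phi> a, y) \<in> F \<and> l (\<phi> a) y = m y \<and> emb D l \<phi> V es \<and> \<phi> b = y"
      using g0[OF x0(1)] unfolding good_def by blast
  qed
  from bchoice[OF this] obtain \<phi> where
    "\<forall>y \<in> snd ` F. (\<phi> y a, y) \<in> F \<and> l (\<phi> y a) y = m y \<and> emb D l (\<phi> y) V es \<and> \<phi> y b = y" ..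
  then have \<phi>: "(\<phi> y a, y) \<in> F \<and> l (\<phi> y a) y = m y \<and> emb D l (\<phi> y) V es \<and> \<phi> y b = y"
    if "(x, y) \<in> F" for x y
    using that by force
  \<comment> \<open>Two kinds of exceptions: \<open>E1\<close> holds the edges with too few later
    edges at \<open>x\<close> to place \<open>Q\<close>, and \<open>E2\<close> those whose row is
    already used by the copy chosen at \<open>y\<close>.\<close>
  define E1 where "E1 = low_rank (\<lambda>x y. - l x y) F K"
  define E2 where "E2 = {(x, y) \<in> F. x \<in> \<phi> y ` V}"
  have finV: "finite V" by (rule row_patternD[OF pat])
  have "card E1 \<le> K * card W"
    unfolding E1_def
  proof (rule card_low_rank[OF finite_W])
    show "F \<subseteq> W \<times> W" using F D_sub by blast
    show "inj_on (\<lambda>y. - l x y) {y. (x, y) \<in> F}" for x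
      using l_inj_row[OF F, of x] by (auto simp: inj_on_def)
  qed
  moreover have "card E2 \<le> K * card W"
  proof -
    have "E2 \<subseteq> prod.swap ` (SIGMA y:W. \<phi> y ` V)" using F D_sub by (force simp: E2_def)
    then have "card E2 \<le> card (prod.swap ` (SIGMA y:W. \<phi> y ` V))"
      by (rule card_mono[rotated]) (use finite_W finV in auto)
    also have "\<dots> \<le> card (SIGMA y:W. \<phi> y ` V)" by (rule card_image_le) (use finite_W finV in auto)
    also have "\<dots> = (\<Sum>y\<in>W. card (\<phi> y ` V))" using finite_W finV by simp
    also have "\<dots> \<le> (\<Sum>y\<in>W. K)"
      by (intro sum_mono order_trans[OF card_image_le[OF finV]]) (simp add: K)
    finally show ?thesis by (simp add: mult.commute)
  qed
  ultimately have "card (E1 \<union> E2) \<le> 2 * K * card W"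
    using card_Un_le[of E1 E2] by linarith
  moreover have "card {z. (x, z) \<in> F \<and> m y < l x z \<and> l x z < l x y} < K"
    if xy: "(x, y) \<in> F" "(x, y) \<notin> E1" "(x, y) \<notin> E2" for x y
  proof (rule ccontr)
    \<comment> \<open>\<open>M\<close> supplies the columns for \<open>P\<close> and
      \<open>N\<close> those for \<open>Q\<close>; each has at least \<open>K\<close> elements,
      enough after deleting the at most \<open>card V\<close> vertices of the copy.\<close>
    define M where "M = {z. (x, z) \<in> F \<and> m y < l x z \<and> l x z < l x y}"
    define N where "N = {z. (x, z) \<in> F \<and> l x y < l x z}"
    assume "\<not> ?thesis"
    then have cM: "K \<le> card M" by (simp add: M_def)
    have cN: "K \<le> card N" using xy(1,2) by (simp add: E1_def low_rank_def N_def)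
    have "M \<subseteq> snd ` F" "N \<subseteq> snd ` F" by (force simp: M_def N_def)+
    then have fin: "finite M" "finite N" using finF finite_surj by blast+
    have cV: "card (\<phi> y ` V) \<le> card V" by (rule card_image_le[OF finV])
    have inj: "inj_on (l x) S" if "S \<subseteq> {z. (x, z) \<in> F}" for S
      using inj_on_subset[OF l_inj_row[OF F] that] .
    have "card M - card (\<phi> y ` V) \<le> card (M - \<phi> y ` V)" "card N - card (\<phi> y ` V) \<le> card (N - \<phi> y ` V)"
      by (rule diff_card_le_card_Diff, simp add: finV)+
    then have "length P \<le> card (M - \<phi> y ` V)" "length Q \<le> card (N - \<phi> y ` V)"
      using cM cN cV K by linarith+
    moreover have "inj_on (l x) (M - \<phi> y ` V)" "inj_on (l x) (N - \<phi> y ` V)"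
      by (rule inj, auto simp: M_def N_def)+
    ultimately obtain zP zQ where zP: "length zP = length P" "set zP \<subseteq> M - \<phi> y ` V" "sorted_wrt (<) (map (l x) zP)"
      and zQ: "length zQ = length Q" "set zQ \<subseteq> N - \<phi> y ` V" "sorted_wrt (<) (map (l x) zQ)"
      using ex_sorted_list fin by (metis finite_Diff)
    have \<phi>y: "l (\<phi> y a) y = m y" "emb D l (\<phi> y) V es" "\<phi> y b = y" using \<phi>[OF xy(1)] by auto
    \<comment> \<open>\<open>K\<close> is positive, so some label lies strictly between
      \<open>m y\<close> and \<open>l x y\<close>; this separates \<open>xy\<close> from the last
      edge of the copy.\<close>
    have "M \<noteq> {}" using cM K by auto
    then have "m y < l x y" by (auto simp: M_def)
    have "good D l (es @ map (Pair a') (P @ b # Q)) (V \<union> set (a' # P @ Q)) a' (last (b # Q)) x (last (y # zQ))"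
    proof (rule emb_extend[OF pat \<phi>y(2,3) new _ _ zP(1) zQ(1)])
      show "(x, y) \<in> D" using xy F by blast
      show "x \<notin> \<phi> y ` V" using xy by (auto simp: E2_def)
      show "(x, z) \<in> D \<and> z \<notin> \<phi> y ` V" if "z \<in> set (zP @ zQ)" for z
        using that zP(2) zQ(2) F by (auto simp: M_def N_def)
      show "l (\<phi> y a) y < l x z" if "z \<in> set (zP @ [y])" for z
        using that zP(2) \<open>m y < l x y\<close> \<phi>y(1) by (auto simp: M_def)
      show "sorted_wrt (<) (map (l x) (zP @ y # zQ))"
        using zP(2,3) zQ(2,3) by (fastforce simp: sorted_wrt_append M_def N_def)
    qed
    \<comment> \<open>The extended copy must end at an edge of \<open>F\<close> to contradict
      \<open>g1\<close>; this is why the new columns were taken within \<open>F\<close>.\<close>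
    moreover have "(x, last (y # zQ)) \<in> F"
    proof (cases "zQ = []")
      case False
      then have "last zQ \<in> N" using zQ(2) last_in_set[of zQ] by blast
      then show ?thesis using False by (simp add: N_def)
    qed (use xy(1) in simp)
    ultimately show False using g1 by blast
  qed
  moreover have "E1 \<union> E2 \<subseteq> F" by (auto simp: E1_def E2_def low_rank_def)
  ultimately show ?thesis by (intro exI[of _ "E1 \<union> E2"]) auto
qed

text \<open>No label of \<open>F\<close> at \<open>x\<close> is below \<open>m\<close>, so the count
  of labels above \<open>m\<close> misses only an edge labelled exactly \<open>m\<close>, and labels
  at \<open>x\<close> are distinct.\<close>

lemma card_le_singleton_extra:
  assumes F: "F \<subseteq> D" and le: "m \<le> m'" and low: "\<And>z. (x, z) \<in> F \<Longrightarrow> m' \<le> l x z"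
    and few: "card {z. (x, z) \<in> F \<and> m < l x z \<and> l x z < c} < K"
  shows "card {z. (x, z) \<in> F \<and> l x z < c} < Suc K"
proof -
  let ?M = "{z. (x, z) \<in> F \<and> m < l x z \<and> l x z < c}"
  let ?S = "{z. (x, z) \<in> F \<and> l x z = m}"
  have "{z. (x, z) \<in> F} \<subseteq> W" using F D_sub by auto
  then have fin: "finite {z. (x, z) \<in> F}" using finite_W finite_subset by blast
  have "{z. (x, z) \<in> F \<and> l x z < c} \<subseteq> ?M \<union> ?S"
    using le low by force
  then have "card {z. (x, z) \<in> F \<and> l x z < c} \<le> card (?M \<union> ?S)"
    by (rule card_mono[rotated]) (use fin in auto)
  also have "\<dots> \<le> card ?M + card ?S" by (rule card_Un_le)
  also have "card ?S \<le> 1"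
  proof -
    have "finite ?S" using fin by (rule rev_finite_subset) auto
    moreover have "z = z'" if "z \<in> ?S" "z' \<in> ?S" for z z'
      using l_inj_row[OF F, of x] that by (auto dest: inj_onD)
    ultimately show ?thesis unfolding One_nat_def by (subst card_le_Suc0_iff_eq) blast+
  qed
  finally show ?thesis using few by linarith
qed

end

section \<open>Counting the bad pairs\<close>

context edge_host
begin

text \<open>Away from the exceptions, if \<open>m y\<close> is at most \<open>m' x\<close>, then
  \<open>xy\<close> is among the \<open>K + 1\<close> lowest edges of \<open>F\<close> at
  \<open>x\<close>; otherwise it is among the \<open>K' + 1\<close> lowest at \<open>y\<close>. The
  exceptions contribute \<open>2 * K + 2 * K'\<close> and the low edges \<open>K + K' + 2\<close>,
  each times \<open>card W\<close>.\<close>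

lemma row_step_count:
  assumes pat: "row_pattern es V a b"
    and new: "distinct (c # P @ Q)" "set (c # P @ Q) \<inter> V = {}"
    and pat': "row_pattern es' V' a' b'"
    and new': "distinct (c' # P' @ Q')" "set (c' # P' @ Q') \<inter> V' = {}"
    and F: "F \<subseteq> D"
    and g0: "\<And>x y. (x, y) \<in> F \<Longrightarrow> good D l es V a b x y"
    and g1: "\<And>x y. (x, y) \<in> F \<Longrightarrow>
      \<not> good D l (es @ map (Pair c) (P @ b # Q)) (V \<union> set (c # P @ Q)) c (last (b # Q)) x y"
    and g0': "\<And>x y. (x, y) \<in> F \<Longrightarrow> good D l es' V' a' b' y x"
    and g1': "\<And>x y. (x, y) \<in> F \<Longrightarrow>
      \<not> good D l (es' @ map (Pair c') (P' @ b' # Q')) (V' \<union> set (c' # P' @ Q')) c' (last (b' # Q')) y x"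
    and K: "K = Suc (card V + length P + length Q)"
    and K': "K' = Suc (card V' + length P' + length Q')"
  shows "card F \<le> (3 * K + 3 * K' + 2) * card W"
proof -
  define m where "m y = Min {l x y | x. (x, y) \<in> F}" for y
  \<comment> \<open>The second pattern has its row at \<open>y\<close>, so its side of the argument
    runs on the converse of \<open>F\<close>.\<close>
  define m' where "m' x = Min {l y x | y. (y, x) \<in> F\<inverse>}" for x
  have F': "F\<inverse> \<subseteq> D" using F D_sym by auto
  obtain E where E: "E \<subseteq> F" "card E \<le> 2 * K * card W"
      "\<forall>(x, y) \<in> F - E. card {z. (x, z) \<in> F \<and> m y < l x z \<and> l x z < l x y} < K"
    using row_step_exceptions[OF pat new F g0 g1 m_def K] by blast
  obtain E' where E': "E' \<subseteq> F\<inverse>" "card E' \<le> 2 * K' * card W"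
      "\<forall>(y, x) \<in> F\<inverse> - E'. card {z. (y, z) \<in> F\<inverse> \<and> m' x < l y z \<and> l y z < l y x} < K'"
    using row_step_exceptions[OF pat' new' F' _ _ m'_def K'] g0' g1' by blast
  define R where "R = low_rank l F (Suc K)"
  define R' where "R' = low_rank l (F\<inverse>) (Suc K')"
  have cR: "card R \<le> Suc K * card W" unfolding R_def
    by (rule card_low_rank[OF finite_W _ l_inj_row[OF F]]) (use F D_sub in blast)
  have cR': "card R' \<le> Suc K' * card W" unfolding R'_def
    by (rule card_low_rank[OF finite_W _ l_inj_row[OF F']]) (use F' D_sub in blast)
  have finF: "finite F" using F finite_D finite_subset by blast
  have min: "m y \<le> l x y" "m' x \<le> l x y" if "(x, y) \<in> F" for x y
  proof -
    have "{l x y | x. (x, y) \<in> F} \<subseteq> (\<lambda>(x, y). l x y) ` F" by force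
    then have "finite {l x y | x. (x, y) \<in> F}" using finF finite_surj by blast
    then show "m y \<le> l x y" unfolding m_def by (rule Min_le) (use that in blast)
    have "{l y x | y. (y, x) \<in> F\<inverse>} \<subseteq> (\<lambda>(x, y). l y x) ` F" by force
    then have "finite {l y x | y. (y, x) \<in> F\<inverse>}" using finF finite_surj by blast
    then show "m' x \<le> l x y" unfolding m'_def by (rule Min_le) (use that l_sym in auto)
  qed
  have "(x, y) \<in> E \<or> (y, x) \<in> E' \<or> (x, y) \<in> R \<or> (y, x) \<in> R'" if xy: "(x, y) \<in> F" for x y
  proof (rule ccontr)
    assume n: "\<not> ?thesis"
    have few: "card {z. (x, z) \<in> F \<and> m y < l x z \<and> l x z < l x y} < K"
      using E(3) n xy by blast
    have few': "card {z. (y, z) \<in> F\<inverse> \<and> m' x < l y z \<and> l y z < l y x} < K'"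
      using E'(3) n xy by blast
    show False
    proof (cases "m y \<le> m' x")
      case True
      have "card {z. (x, z) \<in> F \<and> l x z < l x y} < Suc K"
        by (rule card_le_singleton_extra[OF F True _ few]) (use min in blast)
      then have "(x, y) \<in> R" using xy by (simp add: R_def low_rank_def)
      then show False using n by blast
    next
      case False
      then have "m' x \<le> m y" by simp
      have "card {z. (y, z) \<in> F\<inverse> \<and> l y z < l y x} < Suc K'"
        by (rule card_le_singleton_extra[OF F' \<open>m' x \<le> m y\<close> _ few']) (use min(1) l_sym in auto)
      then have "(y, x) \<in> R'" using xy by (simp add: R'_def low_rank_def)
      then show False using n by blast
    qed
  qed
  then have "F \<subseteq> E \<union> E'\<inverse> \<union> R \<union> R'\<inverse>" by auto
  moreover have "E \<union> E'\<inverse> \<union> R \<union> R'\<inverse> \<subseteq> F"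
    using E(1) E'(1) by (auto simp: R_def R'_def low_rank_def)
  ultimately have "card F \<le> card (E \<union> E'\<inverse> \<union> R \<union> R'\<inverse>)" by simp
  also have "\<dots> \<le> card E + card (E'\<inverse>) + card R + card (R'\<inverse>)"
    by (rule order_trans[OF card_Un_le add_right_mono[OF
        order_trans[OF card_Un_le add_right_mono[OF card_Un_le]]]])
  also have "\<dots> \<le> 2 * K * card W + 2 * K' * card W + Suc K * card W + Suc K' * card W"
    unfolding card_inverse using E(2) E'(2) cR cR' by (intro add_mono)
  finally show ?thesis by (simp add: algebra_simps)
qed

end

text \<open>A single orientation may fail on superlinearly many edges; only the edges on which both
  orientations fail are few. Hence the double induction over two independent patterns.\<close>

lemma bad_pairs_bound:
  assumes "row_pattern (es :: ('a \<times> 'a) list) V a b" and "row_pattern (es' :: ('a \<times> 'a) list) V' a' b'"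
  shows "\<exists>C. \<forall>(W :: 'v set) D l. edge_host W D l \<longrightarrow>
    card {(x, y) \<in> D. \<not> good D l es V a b x y \<and> \<not> good D l es' V' a' b' y x} \<le> C * card W"
  using assms
proof (induction arbitrary: es' V' a' b' rule: row_pattern.induct)
  case (start a b)
  then show ?case by (simp add: good_start)
next
  case (row es V a b c P Q)
  let ?es = "es @ map (Pair c) (P @ b # Q)" and ?V = "V \<union> set (c # P @ Q)" and ?b = "last (b # Q)"
  \<comment> \<open>The outer hypothesis holds for every second pattern and is used with the full
    one; the inner hypothesis shortens the second pattern and keeps the full first one.\<close>
  from row.prems show ?case
  proof (induction rule: row_pattern.induct)
    case (start a' b')
    then show ?case by (simp add: good_start)
  next
    case row': (row es' V' a' b' c' P' Q')
    let ?es' = "es' @ map (Pair c') (P' @ b' # Q')" and ?V' = "V' \<union> set (c' # P' @ Q')"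
      and ?b' = "last (b' # Q')"
    obtain C1 where C1: "\<And>(W :: 'v set) D l. edge_host W D l \<Longrightarrow>
        card {(x, y) \<in> D. \<not> good D l es V a b x y \<and> \<not> good D l ?es' ?V' c' ?b' y x} \<le> C1 * card W"
      using row.IH[OF row_pattern.row[OF row'.hyps]] by blast
    obtain C2 where C2: "\<And>(W :: 'v set) D l. edge_host W D l \<Longrightarrow>
        card {(x, y) \<in> D. \<not> good D l ?es ?V c ?b x y \<and> \<not> good D l es' V' a' b' y x} \<le> C2 * card W"
      using row'.IH by blast
    define K where "K = Suc (card V + length P + length Q)"
    define K' where "K' = Suc (card V' + length P' + length Q')"
    show ?case
    proof (intro exI[of _ "C1 + C2 + (3 * K + 3 * K' + 2)"] allI impI)
      fix W :: "'v set" and D l assume h: "edge_host W D l"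
      interpret edge_host W D l by fact
      \<comment> \<open>Pairs already bad after shortening one of the patterns fall into
        \<open>?B1\<close> or \<open>?B2\<close>. On the rest, \<open>?F\<close>, both shorter
        patterns are good and \<open>row_step_count\<close> applies.\<close>
      let ?B1 = "{(x, y) \<in> D. \<not> good D l es V a b x y \<and> \<not> good D l ?es' ?V' c' ?b' y x}"
      let ?B2 = "{(x, y) \<in> D. \<not> good D l ?es ?V c ?b x y \<and> \<not> good D l es' V' a' b' y x}"
      let ?F = "{(x, y) \<in> D. good D l es V a b x y \<and> \<not> good D l ?es ?V c ?b x y \<and>
        good D l es' V' a' b' y x \<and> \<not> good D l ?es' ?V' c' ?b' y x}"
      have cF: "card ?F \<le> (3 * K + 3 * K' + 2) * card W"
        by (rule row_step_count[OF row.hyps row'.hyps _ _ _ _ _ K_def K'_def]) blast+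
      have "{(x, y) \<in> D. \<not> good D l ?es ?V c ?b x y \<and> \<not> good D l ?es' ?V' c' ?b' y x}
          \<subseteq> ?B1 \<union> ?B2 \<union> ?F" by blast
      moreover have "finite (?B1 \<union> ?B2 \<union> ?F)" by (rule finite_subset[OF _ finite_D]) auto
      ultimately have "card {(x, y) \<in> D. \<not> good D l ?es ?V c ?b x y \<and> \<not> good D l ?es' ?V' c' ?b' y x}
          \<le> card (?B1 \<union> ?B2 \<union> ?F)"
        by (intro card_mono)
      also have "\<dots> \<le> card ?B1 + card ?B2 + card ?F"
        by (rule order_trans[OF card_Un_le add_right_mono[OF card_Un_le]])
      also have "\<dots> \<le> C1 * card W + C2 * card W + (3 * K + 3 * K' + 2) * card W"
        by (intro add_mono C1[OF h] C2[OF h] cF)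
      also have "\<dots> = (C1 + C2 + (3 * K + 3 * K' + 2)) * card W"
        by (simp only: add_mult_distrib)
      finally show "card {(x, y) \<in> D. \<not> good D l ?es ?V c ?b x y \<and> \<not> good D l ?es' ?V' c' ?b' y x}
          \<le> (C1 + C2 + (3 * K + 3 * K' + 2)) * card W" .
    qed
  qed
qed

text \<open>Using the same pattern twice: without any copy, every pair is bad in both
  orientations.\<close>

lemma row_pattern_linear:
  assumes "row_pattern (es :: ('a \<times> 'a) list) V a b"
  shows "\<exists>C. \<forall>(W :: 'v set) D l. edge_host W D l \<longrightarrow> (\<nexists>\<phi>. emb D l \<phi> V es) \<longrightarrow> card D \<le> C * card W"
proof -
  obtain C where C: "\<forall>(W :: 'v set) D l. edge_host W D l \<longrightarrow>
    card {(x, y) \<in> D. \<not> good D l es V a b x y \<and> \<not> good D l es V a b y x} \<le> C * card W"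
    using bad_pairs_bound[OF assms assms] by blast
  have "card D \<le> C * card W" if "edge_host W D l" "\<nexists>\<phi>. emb D l \<phi> V es" for W :: "'v set" and D l
  proof -
    have "\<not> good D l es V a b x y" for x y using that(2) unfolding good_def by blast
    then have eq: "{(x, y) \<in> D. \<not> good D l es V a b x y \<and> \<not> good D l es V a b y x} = D" by simp
    show ?thesis using C[rule_format, OF that(1)] unfolding eq .
  qed
  then show ?thesis by blast
qed

section \<open>From semi-caterpillars to row patterns\<close>

lemma simple_path_exists:
  assumes "(u, v) \<in> R\<^sup>*"
  shows "\<exists>p. p \<noteq> [] \<and> hd p = u \<and> last p = v \<and> distinct p \<and> set p \<subseteq> insert u (Range R) \<and>
    successively (\<lambda>x y. (x, y) \<in> R) p"
  using assms
proof (induction rule: rtrancl_induct)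
  case base
  show ?case by (intro exI[of _ "[u]"]) simp
next
  case (step v w)
  then obtain p where p: "p \<noteq> []" "hd p = u" "last p = v" "distinct p" "set p \<subseteq> insert u (Range R)"
    "successively (\<lambda>x y. (x, y) \<in> R) p" by blast
  show ?case
  proof (cases "w \<in> set p")
    case True
    then obtain p1 p2 where "p = p1 @ w # p2" by (meson split_list)
    then show ?thesis using p
      by (intro exI[of _ "p1 @ [w]"]) (auto simp: successively_append_iff hd_append split: if_splits)
  next
    case False
    then show ?thesis using p step.hyps
      by (intro exI[of _ "p @ [w]"]) (auto simp: successively_append_iff)
  qed
qed

text \<open>Old vertices reach the new row through \<open>b\<close> and new columns reach it
  directly; the last column is a neighbour of that row. Together with a further vertex, such paths
  close up to cycles.\<close>

lemma row_pattern_connected: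
  assumes "row_pattern es V a b" and "v \<in> V"
  shows "(v, b) \<in> {(x, y). (x, y) \<in> set es \<or> (y, x) \<in> set es}\<^sup>*"
  using assms
proof (induction arbitrary: v rule: row_pattern.induct)
  case (row es V a b a' P Q)
  define es' where "es' = es @ map (Pair a') (P @ b # Q)"
  let ?R = "{(x, y). (x, y) \<in> set es' \<or> (y, x) \<in> set es'}"
  have sub: "{(x, y). (x, y) \<in> set es \<or> (y, x) \<in> set es}\<^sup>* \<subseteq> ?R\<^sup>*"
    by (rule rtrancl_mono) (auto simp: es'_def)
  have to_a': "(u, a') \<in> ?R\<^sup>*" if u: "u \<in> V \<union> set (a' # P @ Q)" for u
  proof (cases "u \<in> V")
    case True
    then have "(u, b) \<in> ?R\<^sup>*" using row.IH sub by blast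
    moreover have "(b, a') \<in> ?R" by (simp add: es'_def)
    ultimately show ?thesis by (rule rtrancl_into_rtrancl)
  next
    case False
    then have "u = a' \<or> (u, a') \<in> ?R" using u by (auto simp: es'_def)
    then show ?thesis by auto
  qed
  have "last (b # Q) \<in> set (b # Q)" by (rule last_in_set) simp
  then have "(a', last (b # Q)) \<in> ?R" by (auto simp: es'_def)
  then show ?case using to_a'[OF row.prems] unfolding es'_def by (rule rtrancl_into_rtrancl[rotated])
qed simp

lemma cycle_through_new_vertex:
  assumes p: "p \<noteq> []" "hd p = b" "last p = c" "b \<noteq> c" "distinct p" "set p \<subseteq> verts H"
    and succ: "successively (\<lambda>x y. {x, y} \<in> edges H) p"
    and a: "a \<notin> set p" "a \<in> verts H" "{a, b} \<in> edges H" "{a, c} \<in> edges H"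
  shows "is_cycle H (a # p)"
proof -
  obtain q where q: "p = b # q" using p(1,2) by (cases p) auto
  then have "q \<noteq> []" using p(3,4) by auto
  have succ': "successively (\<lambda>x y. {x, y} \<in> edges H) (a # p)"
    using succ a(3) q by simp
  have "{(a # p) ! i, (a # p) ! Suc i} \<in> edges H" if "Suc i < length (a # p)" for i
    using succ' that unfolding successively_conv_nth by blast
  then show ?thesis
    using p a q \<open>q \<noteq> []\<close> unfolding is_cycle_def by (auto simp: Suc_le_eq insert_commute)
qed

text \<open>The position in the edge order, serving as the integer label of an
  \<open>edge_host\<close>.\<close>

definition edge_rank :: "'a eograph \<Rightarrow> 'a set \<Rightarrow> int" where
  "edge_rank G e = int (card {f. edge_less G f e})"

lemma edge_rank_less_iff:
  assumes G: "edge_ordered_graph G" and e: "e \<in> edges G" "f \<in> edges G"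
  shows "edge_rank G e < edge_rank G f \<longleftrightarrow> edge_less G e f"
proof -
  have mono: "edge_rank G e < edge_rank G f" if less: "edge_less G e f" for e f
  proof -
    have "finite {g. edge_less G g f}"
      by (rule finite_subset[OF _ edge_ordered_graphD(2)[OF G]]) (use edge_less_edges[OF G] in blast)
    moreover have "{g. edge_less G g e} \<subset> {g. edge_less G g f}"
      using less edge_less_trans[OF G] edge_less_irrefl by fast
    ultimately show ?thesis unfolding edge_rank_def by (simp add: psubset_card_mono)
  qed
  show ?thesis using mono[of e f] mono[of f e] edge_less_linear[OF G e] by fastforce
qed

lemma edge_host_of_graph:
  assumes K: "edge_ordered_graph K"
  shows "edge_host (verts K) {(x, y). {x, y} \<in> edges K} (\<lambda>x y. edge_rank K {x, y})"
proof
  show "finite (verts K)" "{(x, y). {x, y} \<in> edges K} \<subseteq> verts K \<times> verts K"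
    using edge_ordered_graphD[OF K] by auto
  show "(x, x) \<notin> {(x, y). {x, y} \<in> edges K}" for x
    using edge_ordered_graphD(4)[OF K, of "{x}"] by auto
  show "{x, y} = {x', y'}"
    if "(x, y) \<in> {(x, y). {x, y} \<in> edges K}" "(x', y') \<in> {(x, y). {x, y} \<in> edges K}"
      "edge_rank K {x, y} = edge_rank K {x', y'}" for x y x' y'
  proof (rule ccontr)
    assume "{x, y} \<noteq> {x', y'}"
    then have "edge_less K {x, y} {x', y'} \<or> edge_less K {x', y'} {x, y}"
      using edge_less_linear[OF K] that by blast
    then show False using edge_rank_less_iff[OF K] that by fastforce
  qed
qed (auto simp: insert_commute)

context row_split
begin

lemma sorted_row:
  obtains zs where "set zs = {c. nb a c}" "distinct zs"
    "sorted_wrt (\<lambda>c d. edge_less G {a, c} {a, d}) zs"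
proof -
  let ?S = "{c. nb a c}" and ?f = "\<lambda>c. edge_rank G {a, c}"
  have fin: "finite ?S"
    by (rule finite_subset[OF _ edge_ordered_graphD(1)[OF eog]]) (use nbD(4) in blast)
  have less: "edge_less G {a, c} {a, d} \<longleftrightarrow> ?f c < ?f d" if "nb a c" "nb a d" for c d
    using edge_rank_less_iff[OF eog] nbD(3) that by blast
  have "inj_on ?f ?S"
  proof (rule inj_onI)
    fix c d assume cd: "c \<in> ?S" "d \<in> ?S" "?f c = ?f d"
    then have "\<not> edge_less G {a, c} {a, d}" "\<not> edge_less G {a, d} {a, c}" using less by auto
    then show "c = d"
      using edge_less_linear[OF eog, of "{a, c}" "{a, d}"] nbD(3) nb_edge_eq[of a c a d] cd by blast
  qed
  then obtain zs where zs: "length zs = card ?S" "set zs \<subseteq> ?S" "sorted_wrt (<) (map ?f zs)"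
    using ex_sorted_list[OF fin order_refl] by blast
  then have "distinct (map ?f zs)" by (simp add: strict_sorted_iff)
  then have dist: "distinct zs" by (simp add: distinct_map)
  then have "set zs = ?S" using zs fin by (intro card_subset_eq) (auto simp: distinct_card)
  moreover have "sorted_wrt (\<lambda>c d. edge_less G {a, c} {a, d}) zs"
    using zs(3) unfolding sorted_wrt_map
    by (rule sorted_wrt_mono_rel[rotated]) (use zs(2) less in blast)
  ultimately show ?thesis using that dist by blast
qed

text \<open>The last edge \<open>ab\<close> of a row and the first edge \<open>a'f\<close> of the
  next row are consecutive. If they meet, then \<open>b = f\<close>. A connecting edge larger than
  both cannot be \<open>af\<close>, which lies in the earlier row, so it is \<open>a'b\<close>, as
  \<open>aa'\<close> and \<open>bf\<close> do not join a row to a column.\<close>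

lemma semi_caterpillar_next_row:
  assumes semi: "semi_caterpillar G"
    and nb: "nb a b" "nb a' b'" and rk: "rk a < rk a'"
    and cons: "\<And>d c. nb d c \<Longrightarrow> \<not> (rk a < rk d \<and> rk d < rk a')"
    and last: "\<And>c. nb a c \<Longrightarrow> \<not> edge_less G {a, b} {a, c}"
  shows "nb a' b"
proof -
  obtain zs where zs: "set zs = {c. nb a' c}" "sorted_wrt (\<lambda>c d. edge_less G {a', c} {a', d}) zs"
    by (rule sorted_row)
  then obtain f zs' where f: "zs = f # zs'" using nb(2) by (cases zs) auto
  then have nf: "nb a' f" using zs(1) by auto
  have first: "\<not> edge_less G {a', c} {a', f}" if "nb a' c" for c
  proof -
    have "c = f \<or> edge_less G {a', f} {a', c}" using zs f that by auto
    then show ?thesis using edge_less_asym[OF eog] edge_less_irrefl by blast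
  qed
  have less: "edge_less G {a, b} {a', f}" by (rule nb_less[OF nb(1) nf rk])
  have "consecutive_edges G {a, b} {a', f}"
    unfolding consecutive_edges_def
  proof (intro conjI notI)
    assume "\<exists>e \<in> edges G. edge_less G {a, b} e \<and> edge_less G e {a', f}"
    then obtain d c where e: "nb d c" "edge_less G {a, b} {d, c}" "edge_less G {d, c} {a', f}"
      using edge_nb by metis
    then have "rk a \<le> rk d" "rk d \<le> rk a'" using nb_rk_le nb(1) nf by blast+
    then have "rk d = rk a \<or> rk d = rk a'" using cons[OF e(1)] by linarith
    then have "d = a \<or> d = a'" using rk_eq e(1) nb by blast
    then show False using last first e by blast
  qed (use nbD(3) nb(1) nf less in auto)
  then consider "{a, b} \<inter> {a', f} \<noteq> {}"
    | u v where "u \<in> {a, b}" "v \<in> {a', f}" "{u, v} \<in> edges G" "edge_less G {a', f} {u, v}"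
    using semi unfolding semi_caterpillar_def by blast
  then show ?thesis
  proof cases
    case 1
    then have "b = f" using nbD(1,2) nb(1) nf rk by auto
    then show ?thesis using nf by simp
  next
    case 2
    consider "u = a" "v = a'" | "u = a" "v = f" | "u = b" "v = a'" | "u = b" "v = f"
      using 2 by blast
    then show ?thesis
    proof cases
      case 1
      then show ?thesis using edge_split[OF 2(3)] nbD(1)[OF nb(1)] nbD(1)[OF nb(2)]
        by (auto simp: doubleton_eq_iff)
    next
      case i: 2
      then have "nb a f" using 2(3) nbD(1)[OF nb(1)] by (simp add: nb_def)
      then show ?thesis using nb_rk_le[OF nf] 2(4) i rk by fastforce
    next
      case 3
      then show ?thesis using 2(3) nbD(1)[OF nb(2)] by (simp add: nb_def insert_commute)
    next
      case 4
      then show ?thesis using edge_split[OF 2(3)] nbD(2)[OF nb(1)] nbD(2)[OF nf]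
        by (auto simp: doubleton_eq_iff)
    qed
  qed
qed

text \<open>Induction on the number of earlier rows: the pattern of the preceding nonempty row is
  extended by all edges of row \<open>a\<close>, attached at the last column of that preceding
  row.\<close>

lemma semi_caterpillar_rows:
  assumes semi: "semi_caterpillar G" and "nb a b'"
  shows "\<exists>es V b. row_pattern es V a b \<and> nb a b \<and> (\<forall>c. nb a c \<longrightarrow> \<not> edge_less G {a, b} {a, c}) \<and>
    set es = {(d, c). nb d c \<and> rk d \<le> rk a} \<and> V \<subseteq> fst ` set es \<union> snd ` set es \<and>
    sorted_wrt (\<lambda>e f. edge_less G {fst e, snd e} {fst f, snd f}) es"
  using assms(2)
proof (induction "card {d \<in> A. rk d < rk a}" arbitrary: a b' rule: less_induct)
  case less
  have aA: "a \<in> A" using nbD(1)[OF less.prems] .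
  obtain zs where zs: "set zs = {c. nb a c}" "distinct zs"
    "sorted_wrt (\<lambda>c d. edge_less G {a, c} {a, d}) zs" by (rule sorted_row)
  define D where "D = {d. (\<exists>c. nb d c) \<and> rk d < rk a}"
  \<comment> \<open>The pattern before row \<open>a\<close> is added. In the edgeless starting
    pattern \<open>b\<close> is an end of no listed edge, hence the \<open>insert b\<close>.\<close>
  have "\<exists>es V a0 b. row_pattern es V a0 b \<and> nb a b \<and> a \<notin> V \<and> V \<inter> {c. nb a c} \<subseteq> {b} \<and>
    set es = {(d, c). nb d c \<and> rk d < rk a} \<and> V \<subseteq> insert b (fst ` set es \<union> snd ` set es) \<and>
    sorted_wrt (\<lambda>e f. edge_less G {fst e, snd e} {fst f, snd f}) es"
  proof (cases "D = {}")
    \<comment> \<open>Row \<open>a\<close> is the first one: start at any of its columns, with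
      \<open>a\<close> itself as the dummy.\<close>
    case True
    have "{(d, c). nb d c \<and> rk d < rk a} = {}" using True by (auto simp: D_def)
    then show ?thesis
      using row_pattern.start[OF nbD(5)[OF less.prems]] less.prems nbD(5)[OF less.prems]
      by (intro exI[of _ "[]"] exI[of _ "{b'}"] exI[of _ a] exI[of _ b']) simp
  next
    case False
    have "D \<subseteq> A" using nbD(1) by (auto simp: D_def)
    then have "finite D" using A_verts edge_ordered_graphD(1)[OF eog] by (meson finite_subset)
    then have "Max (rk ` D) \<in> rk ` D" "\<And>d. d \<in> D \<Longrightarrow> rk d \<le> Max (rk ` D)"
      using False by simp_all
    then obtain a0 where a0: "a0 \<in> D" "\<And>d. d \<in> D \<Longrightarrow> rk d \<le> rk a0" by force
    then obtain b0 where b0: "nb a0 b0" and rk0: "rk a0 < rk a" by (auto simp: D_def)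
    have finA: "finite A" using A_verts edge_ordered_graphD(1)[OF eog] by (meson finite_subset)
    have "card {d \<in> A. rk d < rk a0} < card {d \<in> A. rk d < rk a}"
      by (rule psubset_card_mono) (use finA rk0 nbD(1)[OF b0] in auto)
    from less.hyps[OF this b0] obtain es V b where
      es: "row_pattern es V a0 b" "nb a0 b" "\<And>c. nb a0 c \<Longrightarrow> \<not> edge_less G {a0, b} {a0, c}"
        "set es = {(d, c). nb d c \<and> rk d \<le> rk a0}" "V \<subseteq> fst ` set es \<union> snd ` set es"
        "sorted_wrt (\<lambda>e f. edge_less G {fst e, snd e} {fst f, snd f}) es" by blast
    have rows: "rk d \<le> rk a0 \<longleftrightarrow> rk d < rk a" if "nb d c" for d c
      using a0(2)[of d] rk0 that by (auto simp: D_def)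
    have nab: "nb a b"
      by (rule semi_caterpillar_next_row[OF semi es(2) less.prems rk0 _ es(3)]) (use rows in fastforce)
    have inV: "\<exists>d c. nb d c \<and> rk d \<le> rk a0 \<and> (v = d \<or> v = c)" if v: "v \<in> V" for v
    proof -
      obtain d c where "(d, c) \<in> set es" "v = d \<or> v = c" using es(5) v by force
      then show ?thesis using es(4) by auto
    qed
    have aV: "a \<notin> V" using inV rk0 aA nbD(2) by (metis not_le)
    \<comment> \<open>A second old column of row \<open>a\<close> would be joined to
      \<open>b\<close> inside the pattern, and \<open>a\<close> would close this path to a cycle in
      a tree.\<close>
    have "c = b" if c: "c \<in> V" "nb a c" for c
    proof (rule ccontr)
      assume ne: "c \<noteq> b"
      let ?R = "{(x, y). (x, y) \<in> set es \<or> (y, x) \<in> set es}"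
      have sub: "fst ` set es \<union> snd ` set es \<subseteq> V" by (rule row_patternD(4)[OF es(1)])
      then have RV: "Range ?R \<subseteq> V" by force
      have Vv: "V \<subseteq> verts G" using inV nbD(1,4) A_verts by blast
      obtain p where p: "p \<noteq> []" "hd p = c" "last p = b" "distinct p" "set p \<subseteq> insert c (Range ?R)"
        "successively (\<lambda>x y. (x, y) \<in> ?R) p"
        using simple_path_exists[OF row_pattern_connected[OF es(1) c(1)]] by blast
      have "successively (\<lambda>x y. {x, y} \<in> edges (underlying G)) p"
      proof (rule successively_mono[OF p(6)])
        fix x y assume "(x, y) \<in> ?R"
        then have "nb x y \<or> nb y x" using es(4) by auto
        then show "{x, y} \<in> edges (underlying G)" using nbD(3)[of x y] nbD(3)[of y x] by (auto simp: insert_commute)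
      qed
      moreover have "set p \<subseteq> V" using p(5) RV c(1) by blast
      ultimately have "is_cycle (underlying G) (a # p)"
        using p(1-4) ne Vv aV aA A_verts nbD(3)[OF nab] nbD(3)[OF c(2)]
        by (intro cycle_through_new_vertex[of p c b]) auto
      then show False using semi by (auto simp: semi_caterpillar_def is_tree_def)
    qed
    then have only_b: "V \<inter> {c. nb a c} \<subseteq> {b}" by blast
    have set_es: "set es = {(d, c). nb d c \<and> rk d < rk a}" using es(4) rows by auto
    have V: "V \<subseteq> insert b (fst ` set es \<union> snd ` set es)" using es(5) by blast
    show ?thesis
      by (rule exI[of _ es], rule exI[of _ V], rule exI[of _ a0], rule exI[of _ b])
        (intro conjI es(1) nab aV only_b set_es V es(6))
  qed
  then obtain es V a0 b where es: "row_pattern es V a0 b" and nab: "nb a b" and aV: "a \<notin> V"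
    and only_b: "V \<inter> {c. nb a c} \<subseteq> {b}"
    and set_es: "set es = {(d, c). nb d c \<and> rk d < rk a}"
    and V: "V \<subseteq> insert b (fst ` set es \<union> snd ` set es)"
    and sorted: "sorted_wrt (\<lambda>e f. edge_less G {fst e, snd e} {fst f, snd f}) es"
    by (elim exE conjE) (rule that; assumption)
  \<comment> \<open>The shared column splits the sorted row \<open>a\<close> into the edges before
    it and those after it.\<close>
  obtain P Q where PQ: "zs = P @ b # Q" using nab zs(1) by (metis mem_Collect_eq split_list)
  let ?es = "es @ map (Pair a) (P @ b # Q)" and ?V = "V \<union> set (a # P @ Q)" and ?b = "last (b # Q)"
  have nbset: "set (P @ b # Q) = {c. nb a c}" using zs(1) PQ by simp
  have b_in: "?b \<in> set (b # Q)" by (rule last_in_set) simp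
  have nb_last: "nb a ?b"
  proof -
    have "?b \<in> set (P @ b # Q)" using b_in by (metis UnCI set_append)
    then show ?thesis unfolding nbset by simp
  qed
  have "a \<notin> {c. nb a c}" using nbD(5) by blast
  then have "distinct (a # P @ Q)" using zs(2) PQ nbset by auto
  moreover have "b \<notin> set (P @ Q)" using zs(2) PQ by auto
  then have "set (a # P @ Q) \<inter> V = {}" using only_b nbset aV by auto
  ultimately have "row_pattern ?es ?V a ?b" by (rule row_pattern.row[OF es])
  moreover note nb_last
  moreover have "\<not> edge_less G {a, ?b} {a, c}" if "nb a c" for c
  proof -
    have "last zs = ?b" "zs \<noteq> []" using PQ by simp_all
    then have zs': "zs = butlast zs @ [?b]" by (metis append_butlast_last_id)
    then have "c = ?b \<or> c \<in> set (butlast zs)" using that zs(1)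
      by (metis Un_iff empty_iff empty_set list.simps(15) insert_iff mem_Collect_eq set_append)
    then have "c = ?b \<or> edge_less G {a, c} {a, ?b}"
      using zs(3) zs' by (metis list.set_intros(1) sorted_wrt_append)
    then show ?thesis using edge_less_asym[OF eog] edge_less_irrefl by blast
  qed
  moreover have set_new: "set ?es = {(d, c). nb d c \<and> rk d \<le> rk a}"
  proof -
    have "set ?es = {(d, c). nb d c \<and> rk d < rk a} \<union> Pair a ` {c. nb a c}"
      using set_es nbset by (metis set_append set_map)
    also have "\<dots> = {(d, c). nb d c \<and> rk d \<le> rk a}"
      using rk_eq[OF _ nab] by (auto simp: less_le)
    finally show ?thesis .
  qed
  moreover have "?V \<subseteq> fst ` set ?es \<union> snd ` set ?es"
  proof -
    have img: "fst ` set ?es = fst ` set es \<union> {a}" "snd ` set ?es = snd ` set es \<union> set (P @ b # Q)"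
      by (auto simp: image_Un image_image)
    have "set (a # P @ Q) \<subseteq> {a} \<union> set (P @ b # Q)" "b \<in> set (P @ b # Q)" by auto
    then show ?thesis unfolding img using V by blast
  qed
  moreover have "sorted_wrt (\<lambda>e f. edge_less G {fst e, snd e} {fst f, snd f}) ?es"
    unfolding sorted_wrt_append
  proof (intro conjI ballI)
    show "sorted_wrt (\<lambda>e f. edge_less G {fst e, snd e} {fst f, snd f}) (map (Pair a) (P @ b # Q))"
      using zs(3) unfolding PQ sorted_wrt_map by simp
    fix e f assume ef: "e \<in> set es" "f \<in> set (map (Pair a) (P @ b # Q))"
    have "nb (fst e) (snd e)" "rk (fst e) < rk a" using ef(1) unfolding set_es by auto
    moreover have "fst f = a" "nb a (snd f)" using ef(2) unfolding set_map nbset by auto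
    ultimately show "edge_less G {fst e, snd e} {fst f, snd f}" using nb_less by simp
  qed (rule sorted)
  ultimately show ?case
    by (intro exI[of _ ?es] exI[of _ ?V] exI[of _ ?b] conjI allI impI)
qed

text \<open>The pattern belonging to the last row lists all edges of \<open>G\<close> in increasing
  order, so a host avoiding \<open>G\<close> admits no copy of that pattern.\<close>

lemma semi_caterpillar_linear:
  assumes semi: "semi_caterpillar G"
  shows "\<exists>C. \<forall>n. ex_eo n G \<le> C * n"
proof -
  have conn: "connected_graph (underlying G)" and ed: "edges G \<noteq> {}"
    using semi by (auto simp: semi_caterpillar_def is_tree_def)
  define D where "D = {d. \<exists>c. nb d c}"
  have "D \<subseteq> A" using nbD(1) by (auto simp: D_def)
  then have "finite D" using A_verts edge_ordered_graphD(1)[OF eog] by (meson finite_subset)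
  moreover have "D \<noteq> {}" using ed edge_nb by (auto simp: D_def)
  ultimately have "Max (rk ` D) \<in> rk ` D" "\<And>d. d \<in> D \<Longrightarrow> rk d \<le> Max (rk ` D)" by simp_all
  then obtain a b' where a: "nb a b'" "\<And>d. d \<in> D \<Longrightarrow> rk d \<le> rk a" by (force simp: D_def)
  obtain es V b where pat: "row_pattern es V a b"
    and es: "set es = {(d, c). nb d c \<and> rk d \<le> rk a}"
    and sorted: "sorted_wrt (\<lambda>e f. edge_less G {fst e, snd e} {fst f, snd f}) es"
    using semi_caterpillar_rows[OF semi a(1)] by blast
  have set_es: "set es = {(d, c). nb d c}" using es a(2) by (auto simp: D_def)
  obtain C where C: "\<And>(W :: nat set) D l. edge_host W D l \<Longrightarrow> \<nexists>\<phi>. emb D l \<phi> V es \<Longrightarrow> card D \<le> C * card W"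
    using row_pattern_linear[OF pat] by blast
  \<comment> \<open>A connected graph with an edge has no isolated vertex, so a copy of the edge
    list is injective on all of \<open>verts G\<close>.\<close>
  have verts: "v \<in> fst ` set es \<union> snd ` set es" if v: "v \<in> verts G" for v
  proof -
    have "\<exists>u. {u, v} \<in> edges G"
    proof (cases "v = a")
      case True
      then show ?thesis using nbD(3)[OF a(1)] by (metis insert_commute)
    next
      case False
      have "a \<in> verts G" using nbD(1)[OF a(1)] A_verts by blast
      then have "(a, v) \<in> (adjacency (underlying G))\<^sup>*" using conn v by (simp add: connected_graph_def)
      then show ?thesis using False by (cases rule: rtranclE) (auto simp: adjacency_def)
    qed
    then obtain u where "{u, v} \<in> edges G" by blast
    then obtain d c where "nb d c" "{u, v} = {d, c}" using edge_nb by metis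
    then have "v = d \<or> v = c" "(d, c) \<in> set es" using set_es by (auto simp: doubleton_eq_iff)
    then show ?thesis by force
  qed
  have "ex_eo n G \<le> C * n" for n
  proof (rule ex_eo_le[OF eog ed])
    fix K :: "nat eograph"
    assume K: "edge_ordered_graph K" "card (verts K) = n" and avoid: "\<not> eo_contains K G"
    let ?D = "{(x, y). {x, y} \<in> edges K}" and ?l = "\<lambda>x y. edge_rank K {x, y}"
    interpret host: edge_host "verts K" ?D ?l by (rule edge_host_of_graph[OF K(1)])
    have "\<not> emb ?D ?l \<phi> V es" for \<phi>
    proof
      assume emb: "emb ?D ?l \<phi> V es"
      have VG: "verts G \<subseteq> V" using verts row_patternD(4)[OF pat] by blast
      have img: "{\<phi> d, \<phi> c} \<in> edges K" if "nb d c" for d c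
        using emb set_es that by (auto simp: emb_def)
      have "eo_embeds \<phi> G K"
        unfolding eo_embeds_def
      proof (intro conjI ballI allI impI)
        show "inj_on \<phi> (verts G)" using emb VG inj_on_subset unfolding emb_def by blast
        show "\<phi> ` verts G \<subseteq> verts K"
        proof
          fix y assume "y \<in> \<phi> ` verts G"
          then obtain v where v: "v \<in> verts G" "y = \<phi> v" by blast
          then obtain d c where "(d, c) \<in> set es" "v = d \<or> v = c" using verts[OF v(1)] by force
          then have "nb d c" "y \<in> {\<phi> d, \<phi> c}" using set_es v by auto
          then show "y \<in> verts K" using edge_ordered_graphD(3)[OF K(1) img] by blast
        qed
        show "\<phi> ` e \<in> edges K" if "e \<in> edges G" for e
          using edge_nb[OF that] img by auto
        fix e f assume less: "edge_less G e f"
        then have "e \<in> edges G" "f \<in> edges G" using edge_less_edges[OF eog] by auto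
        then obtain d c d' c' where ef: "nb d c" "e = {d, c}" "nb d' c'" "f = {d', c'}"
          using edge_nb by metis
        then obtain i j where ij: "i < length es" "es ! i = (d, c)" "j < length es" "es ! j = (d', c')"
          using set_es by (metis (no_types, lifting) case_prodI in_set_conv_nth mem_Collect_eq)
        have "\<not> j < i"
          using sorted_wrt_nth_less[OF sorted, of j i] ij edge_less_asym[OF eog less] ef by auto
        moreover have "i \<noteq> j" using ij ef less by auto
        ultimately have "i < j" by simp
        have "sorted_wrt (<) (map (\<lambda>(a, b). ?l (\<phi> a) (\<phi> b)) es)" using emb by (simp add: emb_def)
        from sorted_wrt_nth_less[OF this, of i j] \<open>i < j\<close> ij
        have "edge_rank K {\<phi> d, \<phi> c} < edge_rank K {\<phi> d', \<phi> c'}" by simp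
        then show "edge_less K (\<phi> ` e) (\<phi> ` f)"
          using edge_rank_less_iff[OF K(1) img img] ef by simp
      qed
      then show False using avoid eo_embeds_contains[OF _ eog K(1)] by blast
    qed
    then have "card ?D \<le> C * n" using C[OF host.edge_host_axioms] K(2) by blast
    moreover have "edges K \<subseteq> (\<lambda>(x, y). {x, y}) ` ?D"
    proof
      fix e assume e: "e \<in> edges K"
      then obtain x y where "e = {x, y}" using edge_ordered_graphD(4)[OF K(1)] by (meson card_2_iff)
      then show "e \<in> (\<lambda>(x, y). {x, y}) ` ?D" using e by force
    qed
    then have "card (edges K) \<le> card ?D" by (rule surj_card_le[OF host.finite_D])
    ultimately show "card (edges K) \<le> C * n" by simp
  qed
  then show ?thesis by blast
qed

end

section \<open>The linear upper bound and the dichotomy\<close>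

lemma ex_eo_upper:
  assumes "semi_caterpillar G" and "order_chromatic_number G = 2"
  shows "(\<lambda>n. real (ex_eo n G)) \<in> O(\<lambda>n. real n)"
proof -
  have "edge_ordered_graph G" using assms(1) by (simp add: semi_caterpillar_def)
  then obtain A rk where "row_split G A rk"
    using order_chromatic_number_2_row_split assms(2) by blast
  then obtain C where "\<And>n. ex_eo n G \<le> C * n"
    using row_split.semi_caterpillar_linear assms(1) by blast
  then have "real (ex_eo n G) \<le> real C * real n" for n by (metis of_nat_le_iff of_nat_mult)
  then show ?thesis by (intro bigoI[of _ "real C"]) simp
qed

theorem theorem1:
  fixes G :: "'a eograph"
  assumes "edge_ordered_graph G"
    and "connected_graph (underlying G)"
    and "edges G \<noteq> {}"
  shows "((semi_caterpillar G \<and> order_chromatic_number G = 2) \<or>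
          (semi_caterpillar (reverse_eo G) \<and> order_chromatic_number (reverse_eo G) = 2)
            \<longrightarrow> (\<lambda>n. real (ex_eo n G)) \<in> O(\<lambda>n. real n)) \<and>
         (\<not> ((semi_caterpillar G \<and> order_chromatic_number G = 2) \<or>
             (semi_caterpillar (reverse_eo G) \<and> order_chromatic_number (reverse_eo G) = 2))
            \<longrightarrow> (\<lambda>n. real (ex_eo n G)) \<in> \<Omega>(\<lambda>n. real n * ln (real n)))"
proof (intro conjI impI)
  assume "(semi_caterpillar G \<and> order_chromatic_number G = 2) \<or>
          (semi_caterpillar (reverse_eo G) \<and> order_chromatic_number (reverse_eo G) = 2)"
  then show "(\<lambda>n. real (ex_eo n G)) \<in> O(\<lambda>n. real n)"
    using ex_eo_upper[of G] ex_eo_upper[of "reverse_eo G"] ex_eo_reverse[OF assms(1)] by auto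
next
  assume "\<not> ((semi_caterpillar G \<and> order_chromatic_number G = 2) \<or>
             (semi_caterpillar (reverse_eo G) \<and> order_chromatic_number (reverse_eo G) = 2))"
  then show "(\<lambda>n. real (ex_eo n G)) \<in> \<Omega>(\<lambda>n. real n * ln (real n))"
    by (rule ex_eo_lower[OF assms])
qed

end
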